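(* Let $U$ and $V$ be finite-dimensional vector spaces over $\mathbb{F}_2$ and let $\mathcal{S}\subset\mathcal{L}(U,V)$ be a $3$-dimensional minimal reduced LLD space over $\mathbb{F}_2$. Then one and only one of the following situations holds: (a) $\dim V=2$; (b) $\dim U=2$, $\dim V=3$ and $\mathcal{S}$ is represented by the matrix space associated with $$\begin{bmatrix}\mathbf{x}&0\\ \mathbf{y}&\mathbf{y}\\ 0&\mathbf{z}\end{bmatrix};$$ (c) $\dim U=3$, $\dim V=3$, and one and only one of the following generic matrices is associated with a matrix space that represents $\mathcal{S}$: $$\begin{bmatrix}0&-\mathbf{x}&-\mathbf{y}\\ \mathbf{x}&0&-\mathbf{z}\\ \mathbf{y}&\mathbf{z}&0\end{bmatrix},\quad \begin{bmatrix}0&\mathbf{x}&\mathbf{x}+\mathbf{z}\\ \mathbf{x}&0&\mathbf{y}\\ \mathbf{x}+\mathbf{y}&\mathbf{z}&0\end{bmatrix},$$ $$\begin{bmatrix}\mathbf{x}&0&\mathbf{z}\\ \mathbf{y}&\mathbf{y}&0\\ 0&\mathbf{z}&0\end{bmatrix},\quad \begin{bmatrix}\mathbf{x}&0&\mathbf{y}\\ \mathbf{y}+\mathbf{z}&\mathbf{y}&0\\ 0&\mathbf{z}&0\end{bmatrix},\quad \begin{bmatrix}\mathbf{x}&\mathbf{y}&0\\ \mathbf{y}&\mathbf{y}&\mathbf{z}\\ 0&\mathbf{z}&0\end{bmatrix},\quad \begin{bmatrix}\mathbf{x}&0&\mathbf{y}\\ \mathbf{y}&\mathbf{y}&\mathbf{z}\\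 0&\mathbf{z}&0\end{bmatrix};$$ (d) $\dim U=4$, $\dim V=3$, and one and only one of the following generic matrices is associated with a matrix space that represents $\mathcal{S}$: $$\begin{bmatrix}\mathbf{x}&0&\mathbf{y}&0\\ \mathbf{y}&\mathbf{y}&0&\mathbf{z}\\ 0&\mathbf{z}&0&0\end{bmatrix},\quad \begin{bmatrix}\mathbf{x}&0&\mathbf{y}&\mathbf{z}\\ \mathbf{y}&\mathbf{y}&0&0\\ 0&\mathbf{z}&0&0\end{bmatrix},\quad \begin{bmatrix}\mathbf{x}&0&\mathbf{z}&0\\ \mathbf{y}&\mathbf{y}&0&\mathbf{z}\\ 0&\mathbf{z}&0&0\end{bmatrix},\quad \begin{bmatrix}\mathbf{x}&0&\mathbf{y}&\mathbf{z}\\ \mathbf{y}&\mathbf{y}&\mathbf{z}&0\\ 0&\mathbf{z}&0&0\end{bmatrix}$$ and $$\begin{bmatrix}\mathbf{y}&0&\mathbf{z}&\mathbf{z}\\ 0&\mathbf{z}&\mathbf{x}&0\\ \mathbf{x}&\mathbf{x}&0&\mathbf{y}\end{bmatrix};$$ (e) $\dim U=5$, $\dim V=3$, and $\mathcal{S}$ is represented by the matrix space associated with the generic matrix $$\begin{bmatrix}\mathbf{x}&0&\mathbf{y}&\mathbf{z}&0\\ \mathbf{y}&\mathbf{y}&0&0&\mathbf{z}\\ 0&\mathbf{z}&0&0&0\end{bmatrix}.$$ Conversely, all the matrix spaces listed in (b), (c), (d) and (e) represent $3$-dimensional minimal LLD operator spaces.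
   Context: $\mathcal{L}(U,V)$ is the space of all linear maps from $U$ to $V$. A linear subspace $\mathcal{S}$ of $\mathcal{L}(U,V)$ is reduced when no non-zero vector of $U$ belongs to the kernel of every operator in $\mathcal{S}$ and the span of the ranges of the operators of $\mathcal{S}$ is $V$. It is locally linearly dependent (LLD) when, for every $x\in U$, there is a non-zero operator $s\in\mathcal{S}$ such that $s(x)=0$. It is a minimal LLD space when it is LLD and no proper linear subspace of $\mathcal{S}$ is LLD. The matrix space associated with a generic matrix with $n$ rows and $p$ columns in the independent indeterminates $\mathbf{x},\mathbf{y},\mathbf{z}$ is the linear subspace of $\mathrm{M}_{n,p}(\mathbb{F}_2)$ consisting of all matrices obtained by substituting arbitrary elements of $\mathbb{F}_2$ for the indeterminates. A matrix space $\mathcal{M}\subset \mathrm{M}_{n,p}(\mathbb{F}_2)$ represents $\mathcal{S}\subset\mathcal{L}(U,V)$ when $p=\dim U$, $n=\dim V$ and, for some choice of bases of $U$ and $V$, $\mathcal{M}$ is the set of matrices of the operators in $\mathcal{S}$ in those bases. *)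

theory Defs
  imports "HOL-Library.Z2" "HOL-Library.Function_Algebras" "Jordan_Normal_Form.Matrix"
begin

text \<open>
  A vector space over a field is a type of class \<open>ab_group_add\<close> with a scalar multiplication in
  the sense of \<open>HOL.Vector_Spaces\<close>; the field with two elements is the type \<open>bit\<close>.
  \<open>L(U,V)\<close> is the set \<open>lin_maps\<close>, inside the space of all functions with pointwise operations.
\<close>

definition op_scale :: "('k \<Rightarrow> 'v \<Rightarrow> 'v) \<Rightarrow> 'k \<Rightarrow> ('u \<Rightarrow> 'v) \<Rightarrow> 'u \<Rightarrow> 'v" where
  "op_scale scaleV c s = (\<lambda>x. scaleV c (s x))"

definition lin_maps ::
  "('k::field \<Rightarrow> 'u::ab_group_add \<Rightarrow> 'u) \<Rightarrow> ('k \<Rightarrow> 'v::ab_group_add \<Rightarrow> 'v) \<Rightarrow> ('u \<Rightarrow> 'v) set" where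
  "lin_maps scaleU scaleV = {s. Vector_Spaces.linear scaleU scaleV s}"

definition operator_space ::
  "('k::field \<Rightarrow> 'u::ab_group_add \<Rightarrow> 'u) \<Rightarrow> ('k \<Rightarrow> 'v::ab_group_add \<Rightarrow> 'v) \<Rightarrow> ('u \<Rightarrow> 'v) set \<Rightarrow> bool" where
  "operator_space scaleU scaleV S \<longleftrightarrow>
     S \<subseteq> lin_maps scaleU scaleV \<and> module.subspace (op_scale scaleV) S"

definition operator_dim ::
  "('k::field \<Rightarrow> 'v::ab_group_add \<Rightarrow> 'v) \<Rightarrow> ('u \<Rightarrow> 'v) set \<Rightarrow> nat" where
  "operator_dim scaleV S = vector_space.dim (op_scale scaleV) S"

definition reduced ::
  "('k::field \<Rightarrow> 'v::ab_group_add \<Rightarrow> 'v) \<Rightarrow> ('u::ab_group_add \<Rightarrow> 'v) set \<Rightarrow> bool" where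
  "reduced scaleV S \<longleftrightarrow>
     (\<nexists>x. x \<noteq> 0 \<and> (\<forall>s\<in>S. s x = 0)) \<and> module.span scaleV (\<Union>s\<in>S. range s) = UNIV"

definition LLD :: "('u \<Rightarrow> 'v::ab_group_add) set \<Rightarrow> bool" where
  "LLD S \<longleftrightarrow> (\<forall>x. \<exists>s\<in>S. s \<noteq> 0 \<and> s x = 0)"

definition minimal_LLD ::
  "('k::field \<Rightarrow> 'v::ab_group_add \<Rightarrow> 'v) \<Rightarrow> ('u \<Rightarrow> 'v) set \<Rightarrow> bool" where
  "minimal_LLD scaleV S \<longleftrightarrow>
     LLD S \<and> (\<forall>T. module.subspace (op_scale scaleV) T \<and> T \<subset> S \<longrightarrow> \<not> LLD T)"

definition ordered_basis ::
  "('k::field \<Rightarrow> 'u::ab_group_add \<Rightarrow> 'u) \<Rightarrow> 'u list \<Rightarrow> bool" where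
  "ordered_basis scale bs \<longleftrightarrow>
     distinct bs \<and> \<not> module.dependent scale (set bs) \<and> module.span scale (set bs) = UNIV"

definition op_matrix ::
  "('k::field \<Rightarrow> 'v::ab_group_add \<Rightarrow> 'v) \<Rightarrow> 'u list \<Rightarrow> 'v list \<Rightarrow> ('u \<Rightarrow> 'v) \<Rightarrow> 'k mat" where
  "op_matrix scaleV bs cs s =
     mat (length cs) (length bs)
       (\<lambda>(i, j). module.representation scaleV (set cs) (s (bs ! j)) (cs ! i))"

definition represents ::
  "('k::field \<Rightarrow> 'u::ab_group_add \<Rightarrow> 'u) \<Rightarrow> ('k \<Rightarrow> 'v::ab_group_add \<Rightarrow> 'v) \<Rightarrow>
   'k mat set \<Rightarrow> ('u \<Rightarrow> 'v) set \<Rightarrow> bool" where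
  "represents scaleU scaleV M S \<longleftrightarrow>
     S \<subseteq> lin_maps scaleU scaleV \<and>
     M \<subseteq> carrier_mat (vector_space.dim scaleV UNIV) (vector_space.dim scaleU UNIV) \<and>
     (\<exists>bs cs. ordered_basis scaleU bs \<and> ordered_basis scaleV cs \<and>
        M = op_matrix scaleV bs cs ` S)"

text \<open>
  A generic matrix in the indeterminates \<open>x\<close>, \<open>y\<close>, \<open>z\<close> is given by its substitution map.
\<close>

type_synonym generic_matrix = "bit \<Rightarrow> bit \<Rightarrow> bit \<Rightarrow> bit mat"

definition matrix_space :: "generic_matrix \<Rightarrow> bit mat set" where
  "matrix_space G = {G x y z | x y z. True}"

definition generic_b :: generic_matrix where
  "generic_b x y z = mat_of_rows_list 2
     [[x, 0],
      [y, y],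
      [0, z]]"

definition generic_c :: "generic_matrix list" where
  "generic_c =
   [\<lambda>x y z. mat_of_rows_list 3
     [[0, - x, - y],
      [x, 0, - z],
      [y, z, 0]],
    \<lambda>x y z. mat_of_rows_list 3
     [[0, x, x + z],
      [x, 0, y],
      [x + y, z, 0]],
    \<lambda>x y z. mat_of_rows_list 3
     [[x, 0, z],
      [y, y, 0],
      [0, z, 0]],
    \<lambda>x y z. mat_of_rows_list 3
     [[x, 0, y],
      [y + z, y, 0],
      [0, z, 0]],
    \<lambda>x y z. mat_of_rows_list 3
     [[x, y, 0],
      [y, y, z],
      [0, z, 0]],
    \<lambda>x y z. mat_of_rows_list 3
     [[x, 0, y],
      [y, y, z],
      [0, z, 0]]]"

definition generic_d :: "generic_matrix list" where
  "generic_d =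
   [\<lambda>x y z. mat_of_rows_list 4
     [[x, 0, y, 0],
      [y, y, 0, z],
      [0, z, 0, 0]],
    \<lambda>x y z. mat_of_rows_list 4
     [[x, 0, y, z],
      [y, y, 0, 0],
      [0, z, 0, 0]],
    \<lambda>x y z. mat_of_rows_list 4
     [[x, 0, z, 0],
      [y, y, 0, z],
      [0, z, 0, 0]],
    \<lambda>x y z. mat_of_rows_list 4
     [[x, 0, y, z],
      [y, y, z, 0],
      [0, z, 0, 0]],
    \<lambda>x y z. mat_of_rows_list 4
     [[y, 0, z, z],
      [0, z, x, 0],
      [x, x, 0, y]]]"

definition generic_e :: generic_matrix where
  "generic_e x y z = mat_of_rows_list 5
     [[x, 0, y, z, 0],
      [y, y, 0, 0, z],
      [0, z, 0, 0, 0]]"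

definition exactly_one :: "bool list \<Rightarrow> bool" where
  "exactly_one Ps \<longleftrightarrow> (\<exists>!i. i < length Ps \<and> Ps ! i)"

end

theory Submission
  imports Defs "HOL-Library.Product_Plus"
begin

text \<open>
  The idea is to read the operators from the side of \<open>U\<close>. After a choice of a basis of \<open>S\<close>, a
  vector \<open>u\<close> becomes the linear map \<open>s \<mapsto> s u\<close> from a three-dimensional space to \<open>V\<close>. Local
  linear dependence says that no such map is injective, and minimality says that the kernels of
  those of rank two span \<open>S\<close> (\<open>minimal_LLD_kernel_frame\<close>). When \<open>V\<close> has dimension three, \<open>U\<close> turns
  into a linear space \<open>D\<close> of singular \<open>3 \<times> 3\<close> matrices; a change of bases in \<open>S\<close> and \<open>V\<close> replaces
  \<open>D\<close> by \<open>P D Q\<close> with invertible \<open>P\<close> and \<open>Q\<close>. The generic matrices of the theorem are read in the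
  same way: their columns are bases of such spaces \<open>D\<close>.

  There are two cases. Suppose first that some \<open>u\<close> of rank two with kernel \<open>k\<close> and some \<open>u'\<close>
  satisfy that \<open>k u'\<close> lies outside the image of \<open>u\<close>. Then operators that kill \<open>u\<close>, \<open>u'\<close> and \<open>u + u'\<close>
  form a basis of \<open>S\<close>, in which \<open>u'\<close> and \<open>u\<close> are the diagonal matrices \<open>diag(1,1,0)\<close> and
  \<open>diag(0,1,1)\<close> (\<open>exists_diagonal_pair\<close>). Adding the combinations of these two to an arbitrary
  vector forces all images into the span of the three diagonal directions
  (\<open>diagonal_pair_inside\<close>), so that \<open>V\<close> has dimension three, and then forces \<open>D\<close> to be the sum of
  the two diagonal matrices and of a space of matrices with zero diagonal, each of which has the
  support of an acyclic digraph on three vertices or is the all-ones matrix off the diagonal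
  (\<open>diagonal_decomposition\<close>). A linear space of acyclic digraphs orients each edge in one
  direction only. If the resulting tournament is transitive, \<open>D\<close> is triangular after a
  permutation, and one of only sixteen spaces; the cyclic tournaments and the all-ones matrix
  give few further spaces. Each of these is reduced to a listed one by explicit \<open>P\<close> and \<open>Q\<close>
  (\<open>classify_diagonal\<close>).

  In the other case the kernel of each \<open>u\<close> of rank two is mapped by all vectors into the image of
  \<open>u\<close>. Three vectors whose kernels form a basis then have either the same image, whence \<open>V\<close> is a
  plane, or are the standard basis of the alternating matrices, and \<open>D\<close> is the whole
  alternating space (\<open>classify_stable\<close>).

  Spaces of the same shape are told apart by an isomorphism invariant, the number of triples
  \<open>(s, t, u)\<close> such that \<open>s u\<close> is a value of \<open>t\<close> and \<open>t u\<close> is a value of \<open>s\<close>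
  (\<open>interlocks_models\<close>). The converse is a finite check on the listed spaces
  (\<open>singular_frames\<close>).
\<close>

section \<open>Vector spaces over the field with two elements\<close>

text \<open>
  A scalar of the two-element field is zero or one, so an abelian group carries at most one
  structure of a vector space over it (\<open>scale_eq_bscale\<close>). Working with this one scalar
  multiplication on all types turns linearity into additivity.
\<close>

definition bscale :: "bit \<Rightarrow> 'a::ab_group_add \<Rightarrow> 'a" where
  "bscale a x = (if a = 1 then x else 0)"

lemma bscale_simps [simp]:
  "bscale 0 x = 0" "bscale 1 x = x" "bscale a 0 = 0" "bscale a b = a * b"
  by (cases a; simp add: bscale_def)+

lemma bit_all: "(\<forall>x::bit. P x) \<longleftrightarrow> P 0 \<and> P 1"
  by (metis (full_types) bit.exhaust)

lemma bit_ex: "(\<exists>x::bit. P x) \<longleftrightarrow> P 0 \<or> P 1"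
  by (metis (full_types) bit.exhaust)

lemma vector_space_bscale:
  assumes "\<And>x::'a::ab_group_add. x + x = 0"
  shows "vector_space (bscale :: bit \<Rightarrow> 'a \<Rightarrow> 'a)"
proof
  fix a b :: bit and x y :: 'a
  show "bscale a (x + y) = bscale a x + bscale a y" by (cases a) simp_all
  show "bscale (a + b) x = bscale a x + bscale b x" by (cases a; cases b) (simp_all add: assms)
  show "bscale a (bscale b x) = bscale (a * b) x" by (cases a) simp_all
  show "bscale 1 x = x" by simp
qed

lemma scale_eq_bscale:
  assumes "vector_space (scale :: bit \<Rightarrow> 'a::ab_group_add \<Rightarrow> 'a)"
  shows "scale = bscale"
proof (intro ext)
  interpret vector_space scale by fact
  fix a x show "scale a x = bscale a x" by (cases a) simp_all
qed

lemma double_zero: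
  assumes "vector_space (bscale :: bit \<Rightarrow> 'a::ab_group_add \<Rightarrow> 'a)"
  shows "x + x = (0::'a)"
proof -
  interpret vector_space "bscale :: bit \<Rightarrow> 'a \<Rightarrow> 'a" by fact
  have "x + x = bscale (1 + 1) x" by (simp only: scale_left_distrib scale_one)
  then show ?thesis by simp
qed

lemma vector_space_bit: "vector_space (bscale :: bit \<Rightarrow> bit \<Rightarrow> bit)"
  by (rule vector_space_bscale) simp

lemma vector_space_prod:
  assumes "vector_space (bscale :: bit \<Rightarrow> 'a::ab_group_add \<Rightarrow> 'a)"
    and "vector_space (bscale :: bit \<Rightarrow> 'b::ab_group_add \<Rightarrow> 'b)"
  shows "vector_space (bscale :: bit \<Rightarrow> 'a \<times> 'b \<Rightarrow> 'a \<times> 'b)"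
  by (rule vector_space_bscale)
     (simp add: prod_eq_iff double_zero[OF assms(1)] double_zero[OF assms(2)])

lemma vector_space_fun:
  assumes "vector_space (bscale :: bit \<Rightarrow> 'a::ab_group_add \<Rightarrow> 'a)"
  shows "vector_space (bscale :: bit \<Rightarrow> ('b \<Rightarrow> 'a) \<Rightarrow> 'b \<Rightarrow> 'a)"
  by (rule vector_space_bscale) (simp add: fun_eq_iff double_zero[OF assms])

lemma linear_iff_additive:
  assumes "vector_space (bscale :: bit \<Rightarrow> 'a::ab_group_add \<Rightarrow> 'a)"
    and "vector_space (bscale :: bit \<Rightarrow> 'b::ab_group_add \<Rightarrow> 'b)"
  shows "Vector_Spaces.linear bscale bscale (g :: 'a \<Rightarrow> 'b) \<longleftrightarrow> additive g"
proof -
  have "g (bscale a x) = bscale a (g x)" if "additive g" for a x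
    using additive.zero[OF that] by (cases a) simp_all
  then show ?thesis using assms by (auto simp: Vector_Spaces.linear_iff additive_def)
qed

lemma op_scale_bscale: "op_scale bscale = bscale"
  by (intro ext) (simp add: op_scale_def bscale_def)

lemma subspace_bscale_iff:
  assumes "vector_space (bscale :: bit \<Rightarrow> 'a::ab_group_add \<Rightarrow> 'a)"
  shows "module.subspace bscale (T :: 'a set) \<longleftrightarrow> 0 \<in> T \<and> (\<forall>x\<in>T. \<forall>y\<in>T. x + y \<in> T)"
proof -
  interpret vector_space "bscale :: bit \<Rightarrow> 'a \<Rightarrow> 'a" by fact
  show ?thesis by (auto simp: subspace_def bscale_def)
qed

type_synonym bits = "bit \<times> bit \<times> bit"
type_synonym mat3 = "bits \<times> bits \<times> bits"

lemma vector_space_bits: "vector_space (bscale :: bit \<Rightarrow> bits \<Rightarrow> bits)"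
  by (intro vector_space_prod vector_space_bit)

lemma vector_space_mat3: "vector_space (bscale :: bit \<Rightarrow> mat3 \<Rightarrow> mat3)"
  by (intro vector_space_prod vector_space_bits)

text \<open>
  One function serves as the linear combination of three vectors, as the operator with given
  coordinates in a basis of \<open>S\<close>, and, when the three vectors are columns, as the product of a
  \<open>3 \<times> 3\<close> matrix with a vector.
\<close>

fun comb :: "'a::ab_group_add \<times> 'a \<times> 'a \<Rightarrow> bits \<Rightarrow> 'a" where
  "comb (a, b, c) (x, y, z) = bscale x a + bscale y b + bscale z c"

lemma comb_zero_right [simp]: "comb T 0 = 0"
  by (cases T) (simp add: zero_prod_def)

lemma comb_zero_left [simp]: "comb 0 c = 0"
  by (cases c) (simp add: zero_prod_def)

lemma additive_comb:
  assumes "vector_space (bscale :: bit \<Rightarrow> 'a::ab_group_add \<Rightarrow> 'a)"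
  shows "additive (comb (T :: 'a \<times> 'a \<times> 'a))"
proof
  interpret vector_space "bscale :: bit \<Rightarrow> 'a \<Rightarrow> 'a" by fact
  fix c d :: bits
  show "comb T (c + d) = comb T c + comb T d"
    by (cases T; cases c; cases d) (simp only: comb.simps add_Pair scale_left_distrib ac_simps)
qed

lemma comb_add_left: "comb (S + T) c = comb S c + comb T c"
proof -
  have "bscale a (x + y) = bscale a x + bscale a y" for a and x y :: 'a
    by (cases a) simp_all
  then show ?thesis by (cases S; cases T; cases c) simp
qed

lemma comb_apply: "comb (s, t, r) c u = comb (s u, t u, r u) c"
  by (cases c) (simp add: bscale_def)

lemma additive_comb_eq:
  assumes "additive g"
  shows "g (comb (a, b, c) x) = comb (g a, g b, g c) x"
  using assms by (cases x) (simp add: additive.add additive.zero bscale_def)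

definition units :: mat3 where
  "units = ((1, 0, 0), (0, 1, 0), (0, 0, 1))"

lemma comb_units [simp]: "comb units x = x"
  by (cases x) (simp add: units_def bscale_def zero_prod_def)

lemma additive_eq_comb:
  assumes "additive (g :: bits \<Rightarrow> _)"
  shows "g x = comb (g (1,0,0), g (0,1,0), g (0,0,1)) x"
  using additive_comb_eq[OF assms, of "(1,0,0)" "(0,1,0)" "(0,0,1)" x] comb_units[of x]
  unfolding units_def by simp

definition indep3 :: "'a::ab_group_add \<times> 'a \<times> 'a \<Rightarrow> bool" where
  "indep3 T \<longleftrightarrow> (\<forall>x. comb T x = 0 \<longrightarrow> x = 0)"

lemma additive_inj_iff:
  assumes "additive g"
  shows "inj g \<longleftrightarrow> (\<forall>x. g x = 0 \<longrightarrow> x = 0)"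
proof
  assume "inj g" then show "\<forall>x. g x = 0 \<longrightarrow> x = 0"
    using additive.zero[OF assms] by (metis injD)
next
  assume *: "\<forall>x. g x = 0 \<longrightarrow> x = 0"
  show "inj g"
  proof
    fix x y assume "g x = g y"
    then have "g (x - y) = 0" by (simp add: additive.diff[OF assms])
    then show "x = y" using * by fastforce
  qed
qed

text \<open>
  With coefficients zero and one, a vanishing nontrivial combination of three vectors is a
  coincidence among them, their sums and zero.
\<close>

lemma indep3_iff:
  assumes "vector_space (bscale :: bit \<Rightarrow> 'a::ab_group_add \<Rightarrow> 'a)"
  shows "indep3 (a, b, c :: 'a) \<longleftrightarrow>
    a \<noteq> 0 \<and> b \<noteq> 0 \<and> a \<noteq> b \<and> c \<noteq> 0 \<and> c \<noteq> a \<and> c \<noteq> b \<and> c \<noteq> a + b"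
proof -
  note [simp] = double_zero[OF assms]
  have eq: "x + y = 0 \<longleftrightarrow> x = y" for x y :: 'a
    by (metis \<open>\<And>x::'a. x + x = 0\<close> add_left_cancel)
  show ?thesis
    by (auto simp: indep3_def zero_prod_def bit_all eq)
qed

lemma indep3_inj:
  assumes "vector_space (bscale :: bit \<Rightarrow> 'a::ab_group_add \<Rightarrow> 'a)" "indep3 (T :: 'a \<times> 'a \<times> 'a)"
  shows "inj (comb T)"
  using assms(2) by (simp add: additive_inj_iff[OF additive_comb[OF assms(1)]] indep3_def)

lemma finite_bit: "finite (UNIV :: bit set)"
proof -
  have "(UNIV :: bit set) = {0, 1}" using bit.exhaust by blast
  moreover have "finite {0, 1 :: bit}" by simp
  ultimately show ?thesis by (simp only:)
qed

lemma finite_bits: "finite (UNIV :: bits set)"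
  by (simp add: finite_Prod_UNIV finite_bit)

lemma indep3_bij:
  assumes "indep3 (P :: mat3)"
  shows "bij (comb P)"
  using indep3_inj[OF vector_space_bits assms] finite_UNIV_inj_surj[OF finite_bits] by (simp add: bij_def)

text \<open>
  A matrix is the triple of its columns.
\<close>

fun mult3 :: "mat3 \<Rightarrow> mat3 \<Rightarrow> mat3" where
  "mult3 P (a, b, c) = (comb P a, comb P b, comb P c)"

lemma comb_mult3: "comb (mult3 P m) x = comb P (comb m x)"
  by (cases m) (simp add: additive_comb_eq[OF additive_comb[OF vector_space_bits]])

lemma comb_inject:
  assumes "\<And>x. comb S x = comb T x"
  shows "S = T"
proof -
  obtain a b c a' b' c' where "S = (a, b, c)" "T = (a', b', c')" by (metis prod_cases3)
  then show ?thesis using assms[of "(1, 0, 0)"] assms[of "(0, 1, 0)"] assms[of "(0, 0, 1)"] by simp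
qed

lemma additive_mult3_left: "additive (mult3 P)"
proof
  fix m n :: mat3
  obtain a b c a' b' c' where "m = (a, b, c)" "n = (a', b', c')" by (metis prod_cases3)
  then show "mult3 P (m + n) = mult3 P m + mult3 P n"
    by (simp only: mult3.simps add_Pair additive.add[OF additive_comb[OF vector_space_bits]])
qed

lemma additive_mult3_right: "additive (\<lambda>m. mult3 m Q)"
  by standard (cases Q; simp add: comb_add_left)

text \<open>
  The subset sums of a list: an executable span, with one entry for each subset.
\<close>

fun span_list :: "'a::ab_group_add list \<Rightarrow> 'a list" where
  "span_list [] = [0]"
| "span_list (m # ms) = span_list ms @ map ((+) m) (span_list ms)"

lemma set_span_list:
  assumes "vector_space (bscale :: bit \<Rightarrow> 'a::ab_group_add \<Rightarrow> 'a)"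
  shows "set (span_list ms) = module.span bscale (set ms :: 'a set)"
proof (induction ms)
  interpret vector_space "bscale :: bit \<Rightarrow> 'a \<Rightarrow> 'a" by fact
  case Nil show ?case by simp
next
  interpret vector_space "bscale :: bit \<Rightarrow> 'a \<Rightarrow> 'a" by fact
  case (Cons m ms)
  have "x \<in> (+) m ` span (set ms) \<longleftrightarrow> x - m \<in> span (set ms)" for x
    by (auto simp: image_iff) (metis add_diff_cancel_left' diff_add_cancel add.commute)
  then show ?case using Cons by (auto simp: span_insert bit_ex)
qed

definition all_bits :: "bits list" where
  "all_bits = [(0,0,0), (0,0,1), (0,1,0), (0,1,1), (1,0,0), (1,0,1), (1,1,0), (1,1,1)]"

lemma set_all_bits: "set all_bits = UNIV"
proof -
  have "x \<in> set all_bits" for x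
    by (cases x; rename_tac a b c; case_tac a; case_tac b; case_tac c) (simp_all add: all_bits_def)
  then show ?thesis by blast
qed

lemma distinct_all_bits: "distinct all_bits"
  by (simp add: all_bits_def)

text \<open>
  The space \<open>S\<close> in coordinates: \<open>f\<close> and \<open>h\<close> are bases of \<open>S\<close> and of \<open>V\<close>, and \<open>\<theta> u\<close> is the matrix
  of the map \<open>s \<mapsto> s u\<close>. Injectivity of \<open>\<theta>\<close> is the first half of being reduced. The
  space \<open>U\<close> enters through \<open>D\<close> alone, which makes the notion independent of its dimension.
\<close>

definition models :: "mat3 set \<Rightarrow> ('u::ab_group_add \<Rightarrow> 'v::ab_group_add) set \<Rightarrow> bool" where
  "models D S \<longleftrightarrow> (\<exists>(f :: bits \<Rightarrow> 'u \<Rightarrow> 'v) (h :: bits \<Rightarrow> 'v) (\<theta> :: 'u \<Rightarrow> mat3).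
     additive f \<and> inj f \<and> range f = S \<and> additive h \<and> bij h \<and>
     additive \<theta> \<and> inj \<theta> \<and> range \<theta> = D \<and> (\<forall>c u. f c u = h (comb (\<theta> u) c)))"

definition equivalent :: "mat3 set \<Rightarrow> mat3 set \<Rightarrow> bool" where
  "equivalent D D' \<longleftrightarrow>
     (\<exists>P Q. indep3 P \<and> indep3 Q \<and> (\<lambda>m. mult3 P (mult3 m Q)) ` D = D')"

lemma additive_comp: "additive f \<Longrightarrow> additive g \<Longrightarrow> additive (\<lambda>x. f (g x))"
  by (simp add: additive_def)

lemma additive_inv: "bij f \<Longrightarrow> additive f \<Longrightarrow> additive (inv_into UNIV f)"
  unfolding additive_def by (metis bij_inv_eq_iff)

text \<open>
  Replacing \<open>D\<close> by \<open>P D Q\<close> amounts to changing the basis of \<open>S\<close> by \<open>Q\<close> and that of \<open>V\<close> by the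
  inverse of \<open>P\<close>.
\<close>

lemma models_equivalent:
  assumes "models D S" "equivalent D D'"
  shows "models D' S"
proof -
  obtain f h \<theta> where f: "additive f" "inj f" "range f = S" and h: "additive h" "bij h"
    and th: "additive \<theta>" "inj \<theta>" "range \<theta> = D" and eq: "\<And>c u. f c u = h (comb (\<theta> u) c)"
    using assms(1) unfolding models_def by blast
  obtain P Q where P: "indep3 P" and Q: "indep3 Q" and D': "(\<lambda>m. mult3 P (mult3 m Q)) ` D = D'"
    using assms(2) unfolding equivalent_def by blast
  have bP: "bij (comb P)" and bQ: "bij (comb Q)" using P Q by (simp_all add: indep3_bij)
  note aP = additive_comb[OF vector_space_bits, of P] and aQ = additive_comb[OF vector_space_bits, of Q]
  let ?f = "\<lambda>c. f (comb Q c)" and ?h = "\<lambda>v. h (inv_into UNIV (comb P) v)"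
  let ?th = "\<lambda>u. mult3 P (mult3 (\<theta> u) Q)"
  have "inj ?th"
  proof
    fix u w assume "?th u = ?th w"
    then have "comb P (comb (\<theta> u) (comb Q x)) = comb P (comb (\<theta> w) (comb Q x))" for x
      by (metis comb_mult3)
    then have "comb (\<theta> u) (comb Q x) = comb (\<theta> w) (comb Q x)" for x
      using bP by (simp add: bij_def inj_eq)
    then have "comb (\<theta> u) x = comb (\<theta> w) x" for x
      using bQ by (metis bij_pointE)
    then have "\<theta> u = \<theta> w"
      by (rule comb_inject)
    then show "u = w" using th(2) by (simp add: inj_eq)
  qed
  moreover have "additive ?f"
    by (rule additive_comp[OF f(1) aQ])
  moreover have "additive ?h"
    by (rule additive_comp[OF h(1) additive_inv[OF bP aP]])
  moreover have "additive ?th"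
    by (rule additive_comp[OF additive_mult3_left additive_comp[OF additive_mult3_right th(1)]])
  moreover have "inj ?f" "range ?f = S"
    using f(2,3) bQ inj_compose[of f "comb Q"] image_image[of f "comb Q" UNIV]
    by (simp_all add: bij_def comp_def)
  moreover have "bij ?h"
    using bij_comp[OF bij_imp_bij_inv[OF bP] h(2)] by (simp add: comp_def)
  moreover have "range ?th = D'" using th(3) D' by auto
  moreover have "?f c u = ?h (comb (?th u) c)" for c u
    using bP by (simp add: eq comb_mult3 bij_is_inj)
  ultimately show ?thesis unfolding models_def by blast
qed

section \<open>An isomorphism invariant\<close>

text \<open>
  This number refers to the values of the operators only, so isomorphic operator spaces share it;
  it separates the listed spaces with the same dimension of \<open>U\<close>.
\<close>

definition interlocks :: "('u \<Rightarrow> 'v) set \<Rightarrow> nat" where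
  "interlocks S = card {(s, t, u). s \<in> S \<and> t \<in> S \<and> s u \<in> range t \<and> t u \<in> range s}"

text \<open>
  The next functions count the triples inside the list of all matrices of \<open>D\<close>. Each takes
  already evaluated arguments: the images of the eight operators are computed once and passed on,
  which keeps the evaluation by rewriting short.
\<close>

fun count_row :: "bits \<Rightarrow> bits list \<Rightarrow> (bits \<times> bits list) list \<Rightarrow> int" where
  "count_row v I [] = 0"
| "count_row v I ((w, J) # ys) =
     (if w \<in> set I \<and> v \<in> set J then 1 + count_row v I ys else count_row v I ys)"

fun count_pairs :: "(bits \<times> bits list) list \<Rightarrow> (bits \<times> bits list) list \<Rightarrow> int" where
  "count_pairs [] ys = 0"
| "count_pairs ((v, I) # xs) ys = count_row v I ys + count_pairs xs ys"

definition images :: "mat3 list \<Rightarrow> bits list list" where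
  "images ms = map (\<lambda>c. remdups (map (\<lambda>m. comb m c) ms)) all_bits"

definition diagonal_count :: "(bits \<times> bits list) list \<Rightarrow> int" where
  "diagonal_count xs = count_pairs xs xs"

definition interlocks_at :: "bits list list \<Rightarrow> mat3 \<Rightarrow> int" where
  "interlocks_at Is m = diagonal_count (zip (map (comb m) all_bits) Is)"

definition interlocks_over :: "bits list list \<Rightarrow> mat3 list \<Rightarrow> int" where
  "interlocks_over Is ms = sum_list (map (interlocks_at Is) ms)"

definition interlock_count :: "mat3 list \<Rightarrow> int" where
  "interlock_count ms = interlocks_over (images ms) ms"

lemma count_row_map:
  "count_row v I (map (\<lambda>d. (a d, J d)) ds) = (\<Sum>d\<leftarrow>ds. of_bool (a d \<in> set I \<and> v \<in> set (J d)))"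
  by (induction ds) auto

lemma count_pairs_map:
  "count_pairs (map (\<lambda>c. (a c, I c)) cs) ys = (\<Sum>c\<leftarrow>cs. count_row (a c) (I c) ys)"
  by (induction cs) auto

lemma int_card_triples:
  assumes "finite A" "finite B" "finite C"
  shows "int (card {(a, b, c). a \<in> A \<and> b \<in> B \<and> c \<in> C \<and> P a b c}) =
    (\<Sum>c\<in>C. \<Sum>a\<in>A. \<Sum>b\<in>B. of_bool (P a b c))"
proof -
  have "{(a, b, c). a \<in> A \<and> b \<in> B \<and> c \<in> C \<and> P a b c} = (A \<times> B \<times> C) \<inter> {x. case x of (a, b, c) \<Rightarrow> P a b c}"
    by auto
  then have "int (card {(a, b, c). a \<in> A \<and> b \<in> B \<and> c \<in> C \<and> P a b c}) =
      (\<Sum>x\<in>A \<times> B \<times> C. of_bool (case x of (a, b, c) \<Rightarrow> P a b c))"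
    using assms by (simp add: sum_of_bool_eq)
  also have "\<dots> = (\<Sum>a\<in>A. \<Sum>b\<in>B. \<Sum>c\<in>C. of_bool (P a b c))"
    unfolding sum.cartesian_product by (rule sum.cong) auto
  also have "\<dots> = (\<Sum>a\<in>A. \<Sum>c\<in>C. \<Sum>b\<in>B. of_bool (P a b c))"
    by (rule sum.cong[OF refl]) (rule sum.swap)
  also have "\<dots> = (\<Sum>c\<in>C. \<Sum>a\<in>A. \<Sum>b\<in>B. of_bool (P a b c))"
    by (rule sum.swap)
  finally show ?thesis .
qed

lemma card_triples_range:
  assumes "inj f" "inj g"
  shows "card {(a, b, c). a \<in> range f \<and> b \<in> range f \<and> c \<in> range g \<and> P a b c} =
    card {(x, y, z). P (f x) (f y) (g z)}"
proof -
  have "{(a, b, c). a \<in> range f \<and> b \<in> range f \<and> c \<in> range g \<and> P a b c} =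
      (\<lambda>(x, y, z). (f x, f y, g z)) ` {(x, y, z). P (f x) (f y) (g z)}"
    by (auto simp: image_iff, blast)
  moreover have "inj_on (\<lambda>(x, y, z). (f x, f y, g z)) X" for X
    by (auto intro!: inj_onI simp: inj_eq[OF assms(1)] inj_eq[OF assms(2)])
  ultimately show ?thesis by (simp only: card_image)
qed

lemma interlock_count_eq:
  assumes "distinct ms"
  shows "interlock_count ms = int (card {(c, d, m). c \<in> UNIV \<and> d \<in> UNIV \<and> m \<in> set ms \<and>
     comb m c \<in> (\<lambda>n. comb n d) ` set ms \<and> comb m d \<in> (\<lambda>n. comb n c) ` set ms})"
proof -
  let ?P = "\<lambda>c d m. comb m c \<in> (\<lambda>n. comb n d) ` set ms \<and> comb m d \<in> (\<lambda>n. comb n c) ` set ms"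
  have "interlocks_at (images ms) m = (\<Sum>c\<in>UNIV. \<Sum>d\<in>UNIV. of_bool (?P c d m))" for m
    unfolding interlocks_at_def diagonal_count_def images_def zip_map_map zip_same_conv_map map_map
    by (simp add: comp_def count_row_map count_pairs_map sum_list_distinct_conv_sum_set
        distinct_all_bits set_all_bits conj_commute)
  then have "interlock_count ms = (\<Sum>m\<in>set ms. \<Sum>c\<in>UNIV. \<Sum>d\<in>UNIV. of_bool (?P c d m))"
    using assms by (simp add: interlock_count_def interlocks_over_def sum_list_distinct_conv_sum_set)
  then show ?thesis by (simp only: int_card_triples[OF finite_bits finite_bits finite_set])
qed

lemma interlocks_models:
  assumes "models (set ms) S" "distinct ms"
  shows "int (interlocks S) = interlock_count ms"
proof -
  obtain f h \<theta> where f: "additive f" "inj f" "range f = S" and h: "additive h" "bij h"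
    and th: "additive \<theta>" "inj \<theta>" "range \<theta> = set ms" and eq: "\<And>c u. f c u = h (comb (\<theta> u) c)"
    using assms(1) unfolding models_def by blast
  have in_range: "f c u \<in> range (f d) \<longleftrightarrow> comb (\<theta> u) c \<in> (\<lambda>n. comb n d) ` range \<theta>" for c d u
    using h(2) by (auto simp: eq bij_def inj_eq)
  have "interlocks S = card {(s, t, u). s \<in> range f \<and> t \<in> range f \<and> u \<in> range (\<lambda>x. x) \<and>
      s u \<in> range t \<and> t u \<in> range s}"
    by (simp add: interlocks_def f(3))
  also have "\<dots> = card {(c, d, u). f c u \<in> range (f d) \<and> f d u \<in> range (f c)}"
    by (rule card_triples_range[OF f(2)]) simp
  also have "\<dots> = card {(c, d, m). c \<in> range (\<lambda>x. x) \<and> d \<in> range (\<lambda>x. x) \<and> m \<in> range \<theta> \<and>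
     comb m c \<in> (\<lambda>n. comb n d) ` range \<theta> \<and> comb m d \<in> (\<lambda>n. comb n c) ` range \<theta>}"
    unfolding in_range by (rule card_triples_range[OF _ th(2), symmetric]) simp
  finally show ?thesis unfolding th(3) interlock_count_eq[OF assms(2)] by simp
qed

section \<open>The listed spaces\<close>

text \<open>
  One matrix for each column of the generic matrix: the three columns of a matrix below hold the
  coefficients of \<open>x\<close>, \<open>y\<close> and \<open>z\<close> in that column of the generic matrix. In other words, the
  matrices are the images of the basis vectors of \<open>U\<close>.
\<close>

definition columns_b :: "mat3 list" where
  "columns_b =
   [((1, 0, 0), (0, 1, 0), (0, 0, 0)),
    ((0, 0, 0), (0, 1, 0), (0, 0, 1))]"

definition columns_c :: "mat3 list list" where
  "columns_c =
   [[((0, 1, 0), (0, 0, 1), (0, 0, 0)),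
    ((1, 0, 0), (0, 0, 0), (0, 0, 1)),
    ((0, 0, 0), (1, 0, 0), (0, 1, 0))],
    [((0, 1, 1), (0, 0, 1), (0, 0, 0)),
    ((1, 0, 0), (0, 0, 0), (0, 0, 1)),
    ((1, 0, 0), (0, 1, 0), (1, 0, 0))],
    [((1, 0, 0), (0, 1, 0), (0, 0, 0)),
    ((0, 0, 0), (0, 1, 0), (0, 0, 1)),
    ((0, 0, 0), (0, 0, 0), (1, 0, 0))],
    [((1, 0, 0), (0, 1, 0), (0, 1, 0)),
    ((0, 0, 0), (0, 1, 0), (0, 0, 1)),
    ((0, 0, 0), (1, 0, 0), (0, 0, 0))],
    [((1, 0, 0), (0, 1, 0), (0, 0, 0)),
    ((0, 0, 0), (1, 1, 0), (0, 0, 1)),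
    ((0, 0, 0), (0, 0, 0), (0, 1, 0))],
    [((1, 0, 0), (0, 1, 0), (0, 0, 0)),
    ((0, 0, 0), (0, 1, 0), (0, 0, 1)),
    ((0, 0, 0), (1, 0, 0), (0, 1, 0))]]"

definition columns_d :: "mat3 list list" where
  "columns_d =
   [[((1, 0, 0), (0, 1, 0), (0, 0, 0)),
    ((0, 0, 0), (0, 1, 0), (0, 0, 1)),
    ((0, 0, 0), (1, 0, 0), (0, 0, 0)),
    ((0, 0, 0), (0, 0, 0), (0, 1, 0))],
    [((1, 0, 0), (0, 1, 0), (0, 0, 0)),
    ((0, 0, 0), (0, 1, 0), (0, 0, 1)),
    ((0, 0, 0), (1, 0, 0), (0, 0, 0)),
    ((0, 0, 0), (0, 0, 0), (1, 0, 0))],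
    [((1, 0, 0), (0, 1, 0), (0, 0, 0)),
    ((0, 0, 0), (0, 1, 0), (0, 0, 1)),
    ((0, 0, 0), (0, 0, 0), (1, 0, 0)),
    ((0, 0, 0), (0, 0, 0), (0, 1, 0))],
    [((1, 0, 0), (0, 1, 0), (0, 0, 0)),
    ((0, 0, 0), (0, 1, 0), (0, 0, 1)),
    ((0, 0, 0), (1, 0, 0), (0, 1, 0)),
    ((0, 0, 0), (0, 0, 0), (1, 0, 0))],
    [((0, 0, 1), (1, 0, 0), (0, 0, 0)),
    ((0, 0, 1), (0, 0, 0), (0, 1, 0)),
    ((0, 1, 0), (0, 0, 0), (1, 0, 0)),
    ((0, 0, 0), (0, 0, 1), (1, 0, 0))]]"

definition columns_e :: "mat3 list" where
  "columns_e =
   [((1, 0, 0), (0, 1, 0), (0, 0, 0)),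
    ((0, 0, 0), (0, 1, 0), (0, 0, 1)),
    ((0, 0, 0), (1, 0, 0), (0, 0, 0)),
    ((0, 0, 0), (0, 0, 0), (1, 0, 0)),
    ((0, 0, 0), (0, 0, 0), (0, 1, 0))]"


text \<open>
  A list is linearly independent as soon as its subset sums are pairwise distinct. This turns
  independence of a listed family into an evaluation.
\<close>

lemma span_list_distinctD:
  assumes "vector_space (bscale :: bit \<Rightarrow> 'a::ab_group_add \<Rightarrow> 'a)" "distinct (span_list ms)"
  shows "distinct ms \<and> \<not> module.dependent bscale (set ms :: 'a set)"
  using assms(2)
proof (induction ms)
  interpret vector_space "bscale :: bit \<Rightarrow> 'a \<Rightarrow> 'a" by fact
  case Nil then show ?case by (simp add: independent_empty)
next
  interpret vector_space "bscale :: bit \<Rightarrow> 'a \<Rightarrow> 'a" by fact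
  case (Cons m ms)
  have "0 \<in> set (span_list ms)"
    by (simp add: set_span_list[OF assms(1)] span_zero)
  moreover have "m + m = 0" by (rule double_zero[OF assms(1)])
  ultimately have "m \<notin> set (span_list ms)" using Cons.prems by (auto simp: image_iff)
  then have "m \<notin> span (set ms)" by (simp add: set_span_list[OF assms(1)])
  then show ?case using Cons by (auto simp: independent_insertI span_base)
qed

lemma independent_frame:
  assumes V: "vector_space (bscale :: bit \<Rightarrow> 'a::ab_group_add \<Rightarrow> 'a)" and "indep3 (a, b, c :: 'a)"
  shows "distinct [a, b, c]" "\<not> module.dependent bscale {a, b, c}"
    "module.span bscale {a, b, c} = range (comb (a, b, c))"
proof -
  interpret vector_space "bscale :: bit \<Rightarrow> 'a \<Rightarrow> 'a" by fact
  have *: "a \<noteq> 0 \<and> b \<noteq> 0 \<and> a \<noteq> b \<and> c \<noteq> 0 \<and> c \<noteq> a \<and> c \<noteq> b \<and> c \<noteq> a + b"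
    using assms by (simp add: indep3_iff)
  have span1: "span {x} = {0, x}" for x :: 'a by (auto simp: span_singleton image_iff bit_ex)
  have eq: "x - y = z \<longleftrightarrow> x = y + z" for x y z :: 'a by (auto simp: algebra_simps)
  have span2: "span {x, y} = {0, x, y, x + y}" for x y :: 'a
    by (auto simp: span_insert[of x] span1 bit_ex eq)
  show "distinct [a, b, c]" using * by auto
  have "\<not> dependent {a}" using * by (simp add: dependent_single)
  moreover have "b \<notin> span {a}" using * by (auto simp: span1)
  moreover have "c \<notin> span {b, a}" using * by (auto simp: span2 add.commute)
  ultimately have "\<not> dependent {c, b, a}" by (metis independent_insertI)
  then show "\<not> dependent {a, b, c}" by (simp add: insert_commute)
  show "span {a, b, c} = range (comb (a, b, c))"
    unfolding set_all_bits[symmetric]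
    by (auto simp: span_insert[of a] span2 bit_ex eq all_bits_def add.assoc)
qed

lemma basis_frame:
  assumes V: "vector_space (bscale :: bit \<Rightarrow> 'a::ab_group_add \<Rightarrow> 'a)" and "indep3 (a, b, c :: 'a)"
    "range (comb (a, b, c)) = UNIV"
  shows "ordered_basis bscale [a, b, c]" "vector_space.dim bscale (UNIV :: 'a set) = 3"
proof -
  interpret vector_space "bscale :: bit \<Rightarrow> 'a \<Rightarrow> 'a" by fact
  note fr = independent_frame[OF assms(1,2)]
  show "ordered_basis bscale [a, b, c]"
    using fr assms(3) by (simp add: ordered_basis_def)
  have "card {a, b, c} = 3" using fr(1) by simp
  then show "dim (UNIV :: 'a set) = 3" 
    using dim_eq_card[of "{a, b, c}" UNIV] fr assms(3) by simp
qed

lemma operator_dim_frame: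
  assumes V: "vector_space (bscale :: bit \<Rightarrow> 'v::ab_group_add \<Rightarrow> 'v)"
    and f: "additive (f :: bits \<Rightarrow> 'u \<Rightarrow> 'v)" "inj f"
  shows "operator_dim bscale (range f) = 3"
proof -
  let ?a = "f (1,0,0)" and ?b = "f (0,1,0)" and ?c = "f (0,0,1)"
  note VF = vector_space_fun[OF V]
  interpret vector_space "bscale :: bit \<Rightarrow> ('u \<Rightarrow> 'v) \<Rightarrow> 'u \<Rightarrow> 'v" by fact
  have fc: "comb (?a, ?b, ?c) = f" by (rule ext) (rule additive_eq_comb[OF f(1), symmetric])
  have "indep3 (?a, ?b, ?c)"
    using f(2) unfolding indep3_def fc additive_inj_iff[OF f(1)] .
  note fr = independent_frame[OF VF this]
  have "card {?a, ?b, ?c} = 3" using fr(1) by simp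
  then have "dim (range f) = 3"
    using dim_eq_card[of "{?a, ?b, ?c}" "range f"] fr(2,3) unfolding fc by (metis span_span)
  then show ?thesis by (simp add: operator_dim_def op_scale_bscale)
qed

text \<open>
  Some matrix of the list has its kernel inside the line through \<open>k\<close>. A subspace of operators that
  is locally linearly dependent must then contain the operator with coordinates \<open>k\<close>.
\<close>

definition kernel_vector :: "mat3 list \<Rightarrow> bits \<Rightarrow> bool" where
  "kernel_vector ms k \<longleftrightarrow> (\<exists>m\<in>set ms. \<forall>c\<in>set all_bits. comb m c = 0 \<longrightarrow> c = 0 \<or> c = k)"

text \<open>
  A finite condition under which the space spanned by \<open>ms\<close> models minimal LLD spaces: its members
  are singular, and the columns of \<open>K\<close> are a basis of kernel vectors.
\<close>

definition singular_frame :: "mat3 list \<Rightarrow> mat3 \<Rightarrow> bool" where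
  "singular_frame ms K \<longleftrightarrow>
     distinct (span_list ms) \<and>
     (\<forall>m\<in>set (span_list ms). \<exists>c\<in>set all_bits. c \<noteq> 0 \<and> comb m c = 0) \<and>
     (\<forall>c\<in>set all_bits. comb K c = 0 \<longrightarrow> c = 0) \<and>
     kernel_vector (span_list ms) (comb K (1,0,0)) \<and> kernel_vector (span_list ms) (comb K (0,1,0)) \<and>
     kernel_vector (span_list ms) (comb K (0,0,1))"

lemma singular_frames:
  "singular_frame columns_b units"
  "\<forall>ms\<in>set columns_c. \<exists>K\<in>set [units, ((1, 0, 0), (0, 1, 0), (0, 1, 1)), ((1, 0, 0), (1, 1, 0), (0, 0, 1))].
     singular_frame ms K"
  "\<forall>ms\<in>set columns_d. singular_frame ms units"
  "singular_frame columns_e units"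
  by code_simp+

lemma interlock_counts:
  "map (\<lambda>ms. interlock_count (span_list ms)) columns_c = [260, 212, 240, 224, 228, 236]"
  "map (\<lambda>ms. interlock_count (span_list ms)) columns_d = [528, 520, 544, 592, 508]"
  by code_simp+

section \<open>Models and the matrix spaces that represent them\<close>

lemma singular_frame_nondegenerate:
  assumes K: "singular_frame ms K" and 0: "\<forall>m\<in>set (span_list ms). comb m c = 0"
  shows "c = 0"
proof -
  have "c = 0 \<or> c = comb K (1,0,0)" "c = 0 \<or> c = comb K (0,1,0)"
    using K 0 unfolding singular_frame_def kernel_vector_def set_all_bits by blast+
  then have "c = 0 \<or> comb K (1,0,0) = comb K (0,1,0)" by metis
  moreover have "inj (comb K)"
    using indep3_inj[OF vector_space_bits] K unfolding singular_frame_def set_all_bits indep3_def by blast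
  ultimately show ?thesis by (auto dest: injD simp del: comb.simps)
qed

text \<open>
  Each kernel vector has to lie in every LLD subspace of \<open>S\<close>, because the matrix it belongs to kills
  nothing else. As the kernel vectors contain a basis, no proper subspace of \<open>S\<close> is LLD.
\<close>

lemma models_minimal_LLD:
  assumes V: "vector_space (bscale :: bit \<Rightarrow> 'v::ab_group_add \<Rightarrow> 'v)"
    and m: "models (set (span_list ms)) (S :: ('u::ab_group_add \<Rightarrow> 'v) set)"
    and K: "singular_frame ms K"
  shows "minimal_LLD bscale S"
proof -
  obtain f h \<theta> where f: "additive f" "inj f" "range f = S" and h: "additive h" "bij h"
    and th: "additive \<theta>" "inj \<theta>" "range \<theta> = set (span_list ms)" and eq: "\<And>c u. f c u = h (comb (\<theta> u) c)"
    using m unfolding models_def by blast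
  have f0: "f c = 0 \<longleftrightarrow> c = 0" for c
    using f(2) additive.zero[OF f(1)] by (metis injD)
  have h0: "h v = 0 \<longleftrightarrow> v = 0" for v
    using h(2) additive.zero[OF h(1)] by (metis bij_def injD)
  have "\<exists>s\<in>S. s \<noteq> 0 \<and> s u = 0" for u
  proof -
    have "\<theta> u \<in> set (span_list ms)" using th(3) by blast
    then obtain c where "c \<noteq> 0" "comb (\<theta> u) c = 0"
      using K unfolding singular_frame_def by blast
    then show ?thesis using f(3) f0 h0 eq by (metis rangeI)
  qed
  then have "LLD S" by (simp add: LLD_def)
  moreover have "T = S" if T: "module.subspace (op_scale bscale) T" "T \<subseteq> S" "LLD T" for T
  proof -
    have sub: "0 \<in> T" "\<And>s t. s \<in> T \<Longrightarrow> t \<in> T \<Longrightarrow> s + t \<in> T"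
      using T(1) unfolding op_scale_bscale subspace_bscale_iff[OF vector_space_fun[OF V]] by blast+
    have mem: "f k \<in> T" if k: "kernel_vector (span_list ms) k" for k
    proof -
      obtain m where m: "m \<in> range \<theta>" "\<forall>c. comb m c = 0 \<longrightarrow> c = 0 \<or> c = k"
        using k unfolding kernel_vector_def th(3) set_all_bits by blast
      then obtain u where u: "m = \<theta> u" by blast
      obtain s where s: "s \<in> T" "s \<noteq> 0" "s u = 0" using T(3) unfolding LLD_def by blast
      then obtain c where c: "s = f c" using T(2) f(3) by blast
      then have "comb m c = 0" using s(3) eq u h0 by simp
      then show ?thesis using m(2) s(1,2) c f0 by blast
    qed
    have inK: "indep3 K" using K unfolding singular_frame_def set_all_bits indep3_def by blast
    let ?k = "\<lambda>c. f (comb K c)"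
    have ak: "additive ?k"
      by (rule additive_comp[OF f(1) additive_comb[OF vector_space_bits]])
    have "f (comb K (1,0,0)) \<in> T" "f (comb K (0,1,0)) \<in> T" "f (comb K (0,0,1)) \<in> T"
      using K unfolding singular_frame_def by (blast intro: mem)+
    then have "comb (?k (1,0,0), ?k (0,1,0), ?k (0,0,1)) (x, y, z) \<in> T" for x y z
      unfolding comb.simps using sub by (auto simp: bscale_def)
    then have "?k c \<in> T" for c
      unfolding additive_eq_comb[OF ak, of c] by (cases c) simp
    moreover have "surj (comb K)" using indep3_bij[OF inK] by (simp add: bij_def)
    ultimately have "range f \<subseteq> T" by (metis image_subsetI surjD)
    then show "T = S" using T(2) f(3) by blast
  qed
  ultimately show ?thesis unfolding minimal_LLD_def by blast
qed

lemma models_operator_space: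
  assumes U: "vector_space (bscale :: bit \<Rightarrow> 'u::ab_group_add \<Rightarrow> 'u)"
    and V: "vector_space (bscale :: bit \<Rightarrow> 'v::ab_group_add \<Rightarrow> 'v)"
    and m: "models D (S :: ('u \<Rightarrow> 'v) set)"
  shows "operator_space bscale bscale S" "operator_dim bscale S = 3"
proof -
  obtain f h \<theta> where f: "additive f" "inj f" "range f = S" and h: "additive h" "bij h"
    and th: "additive \<theta>" "inj \<theta>" "range \<theta> = D" and eq: "\<And>c u. f c u = h (comb (\<theta> u) c)"
    using m unfolding models_def by blast
  show "operator_dim bscale S = 3"
    using operator_dim_frame[OF V f(1,2)] f(3) by simp
  have fc: "f c = (\<lambda>u. h (comb (\<theta> u) c))" for c using eq by blast
  have "additive (f c)" for c
    unfolding fc using h(1) th(1) by (auto simp only: additive_def comb_add_left)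
  then have "S \<subseteq> lin_maps bscale bscale"
    unfolding lin_maps_def linear_iff_additive[OF U V] using f(3) by blast
  moreover have "0 \<in> S" "\<And>s t. s \<in> S \<Longrightarrow> t \<in> S \<Longrightarrow> s + t \<in> S"
    unfolding f(3)[symmetric] using additive.zero[OF f(1)] additive.add[OF f(1)]
    by (metis rangeI, metis (no_types) imageE rangeI)
  ultimately show "operator_space bscale bscale S"
    unfolding operator_space_def op_scale_bscale subspace_bscale_iff[OF vector_space_fun[OF V]] by blast
qed

fun entry :: "bits \<Rightarrow> nat \<Rightarrow> bit" where
  "entry (a, b, c) i = [a, b, c] ! i"

text \<open>
  The generic matrix with prescribed columns: its value at \<open>(x, y, z)\<close> has as its \<open>j\<close>-th column the
  product of the \<open>j\<close>-th matrix with \<open>(x, y, z)\<close>.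
\<close>

definition generic_of :: "mat3 list \<Rightarrow> generic_matrix" where
  "generic_of ms x y z = mat 3 (length ms) (\<lambda>(i, j). entry (comb (ms ! j) (x, y, z)) i)"

lemma bscale_Pair: "bscale a (x, y) = (bscale a x, bscale a y)"
  by (simp add: bscale_def zero_prod_def)

lemma generic_of_columns:
  "generic_b = generic_of columns_b"
  "generic_c = map generic_of columns_c"
  "generic_d = map generic_of columns_d"
  "generic_e = generic_of columns_e"
  by (simp_all add: fun_eq_iff bscale_Pair generic_of_def generic_b_def generic_c_def generic_d_def generic_e_def
      columns_b_def columns_c_def columns_d_def columns_e_def mat_of_rows_list_def mat_eq_iff
      less_Suc_eq numeral_3_eq_3 numeral_2_eq_2 eval_nat_numeral all_conj_distrib)

lemma op_matrix_frame:
  assumes V: "vector_space (bscale :: bit \<Rightarrow> 'v::ab_group_add \<Rightarrow> 'v)"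
    and v: "indep3 (v1, v2, v3 :: 'v)"
    and s: "\<And>j. j < length bs \<Longrightarrow> s (bs ! j) = comb (v1, v2, v3) (comb (ms ! j) (x, y, z))"
    and len: "length bs = length ms"
  shows "op_matrix bscale bs [v1, v2, v3] s = generic_of ms x y z"
proof -
  interpret vector_space "bscale :: bit \<Rightarrow> 'v \<Rightarrow> 'v" by fact
  note fr = independent_frame[OF V v]
  have sp: "v1 \<in> span {v1, v2, v3}" "v2 \<in> span {v1, v2, v3}" "v3 \<in> span {v1, v2, v3}"
    by (simp_all add: span_base)
  have "representation {v1, v2, v3} (comb (v1, v2, v3) c) ([v1, v2, v3] ! i) = entry c i" if "i < 3" for c i
  proof (cases c)
    fix a b d assume c: "c = (a, b, d)"
    show ?thesis using fr(1) that unfolding c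
      by (auto simp: representation_add representation_scale representation_basis fr(2) sp
          span_add span_scale less_Suc_eq numeral_3_eq_3)
  qed
  then show ?thesis using s len by (auto simp: op_matrix_def generic_of_def mat_eq_iff)
qed

lemma op_matrix_inject:
  assumes U: "vector_space (bscale :: bit \<Rightarrow> 'u::ab_group_add \<Rightarrow> 'u)"
    and V: "vector_space (bscale :: bit \<Rightarrow> 'v::ab_group_add \<Rightarrow> 'v)"
    and bs: "ordered_basis bscale (bs :: 'u list)" and cs: "ordered_basis bscale (cs :: 'v list)"
    and s: "additive s" and t: "additive t"
    and eq: "op_matrix bscale bs cs s = op_matrix bscale bs cs t"
  shows "s = t"
proof
  fix u
  interpret U: vector_space "bscale :: bit \<Rightarrow> 'u \<Rightarrow> 'u" by fact
  interpret V: vector_space "bscale :: bit \<Rightarrow> 'v \<Rightarrow> 'v" by fact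
  interpret vector_space_pair "bscale :: bit \<Rightarrow> 'u \<Rightarrow> 'u" "bscale :: bit \<Rightarrow> 'v \<Rightarrow> 'v" ..
  have "s b = t b" if "b \<in> set bs" for b
  proof -
    obtain j where j: "j < length bs" "b = bs ! j" using \<open>b \<in> set bs\<close> by (metis in_set_conv_nth)
    have "V.representation (set cs) (s b) c = V.representation (set cs) (t b) c" if "c \<in> set cs" for c
    proof -
      obtain i where i: "i < length cs" "c = cs ! i" using \<open>c \<in> set cs\<close> by (metis in_set_conv_nth)
      have "op_matrix bscale bs cs s $$ (i, j) = op_matrix bscale bs cs t $$ (i, j)" by (simp add: eq)
      then show ?thesis using i j by (simp add: op_matrix_def)
    qed
    then have "(\<Sum>c\<in>set cs. bscale (V.representation (set cs) (s b) c) c) =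
        (\<Sum>c\<in>set cs. bscale (V.representation (set cs) (t b) c) c)" by simp
    moreover have "(\<Sum>c\<in>set cs. bscale (V.representation (set cs) v c) c) = v" for v
      by (rule V.sum_representation_eq) (use cs in \<open>auto simp: ordered_basis_def\<close>)
    ultimately show "s b = t b" by simp
  qed
  then show "s u = t u"
    using linear_eq_on[of s t u "set bs"] s t bs
    by (simp add: linear_iff_additive[OF U V] ordered_basis_def)
qed

text \<open>
  The basis of \<open>U\<close> is the preimage of \<open>ms\<close> under \<open>\<theta>\<close>, and that of \<open>V\<close> is the image of the unit
  vectors.
\<close>

lemma models_represents:
  assumes U: "vector_space (bscale :: bit \<Rightarrow> 'u::ab_group_add \<Rightarrow> 'u)"
    and V: "vector_space (bscale :: bit \<Rightarrow> 'v::ab_group_add \<Rightarrow> 'v)"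
    and dist: "distinct (span_list ms)"
    and m: "models (set (span_list ms)) (S :: ('u \<Rightarrow> 'v) set)"
  shows "represents bscale bscale (matrix_space (generic_of ms)) S"
    "vector_space.dim bscale (UNIV :: 'u set) = length ms"
    "vector_space.dim bscale (UNIV :: 'v set) = 3"
proof -
  obtain f h \<theta> where f: "additive f" "inj f" "range f = S" and h: "additive h" "bij h"
    and th: "additive \<theta>" "inj \<theta>" "range \<theta> = set (span_list ms)" and eq: "\<And>c u. f c u = h (comb (\<theta> u) c)"
    using m unfolding models_def by blast
  interpret U: vector_space "bscale :: bit \<Rightarrow> 'u \<Rightarrow> 'u" by fact
  interpret V: vector_space "bscale :: bit \<Rightarrow> 'v \<Rightarrow> 'v" by fact
  interpret M: vector_space "bscale :: bit \<Rightarrow> mat3 \<Rightarrow> mat3" by (rule vector_space_mat3)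
  interpret UM: vector_space_pair "bscale :: bit \<Rightarrow> 'u \<Rightarrow> 'u" "bscale :: bit \<Rightarrow> mat3 \<Rightarrow> mat3" ..
  interpret MU: vector_space_pair "bscale :: bit \<Rightarrow> mat3 \<Rightarrow> mat3" "bscale :: bit \<Rightarrow> 'u \<Rightarrow> 'u" ..
  let ?v1 = "h (1,0,0)" and ?v2 = "h (0,1,0)" and ?v3 = "h (0,0,1)"
  have hv: "comb (?v1, ?v2, ?v3) = h" by (rule ext) (rule additive_eq_comb[OF h(1), symmetric])
  have v: "indep3 (?v1, ?v2, ?v3)"
    using h(2) unfolding indep3_def hv bij_def additive_inj_iff[OF h(1)] by blast
  have surj_v: "range (comb (?v1, ?v2, ?v3)) = UNIV" using h(2) unfolding hv by (simp add: bij_def)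
  note bv = basis_frame[OF V v surj_v]
  show dimV: "V.dim (UNIV :: 'v set) = 3" by (rule bv)
  have ms: "distinct ms" "M.independent (set ms)"
    using span_list_distinctD[OF vector_space_mat3 dist] by blast+
  have spm: "range \<theta> = M.span (set ms)" using th(3) by (simp add: set_span_list[OF vector_space_mat3])
  have lin: "Vector_Spaces.linear bscale bscale \<theta>" using th(1) by (simp only: linear_iff_additive[OF U vector_space_mat3])
  then obtain g where g: "Vector_Spaces.linear bscale bscale g" "g \<circ> \<theta> = id"
    using UM.linear_injective_left_inverse[OF lin th(2)] by blast
  have g\<theta>: "g (\<theta> u) = u" for u using g(2) by (metis comp_apply id_apply)
  have \<theta>g: "\<theta> (g m) = m" if "m \<in> M.span (set ms)" for m
    using that unfolding spm[symmetric] by (auto simp: g\<theta>)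
  have inj_g: "inj_on g (M.span (set ms))" by (rule inj_on_inverseI) (rule \<theta>g)
  let ?bs = "map g ms"
  have "U.independent (set ?bs)"
    using MU.linear_independent_injective_image[OF g(1) ms(2) inj_g] by simp
  moreover have "U.span (set ?bs) = UNIV"
  proof -
    have "U.span (set ?bs) = g ` M.span (set ms)" by (simp add: MU.linear_span_image[OF g(1)])
    also have "\<dots> = UNIV" unfolding spm[symmetric] by (auto simp: image_image g\<theta>)
    finally show ?thesis .
  qed
  moreover have "distinct ?bs"
    using ms(1) inj_on_subset[OF inj_g M.span_superset] by (simp add: distinct_map)
  ultimately have bs: "ordered_basis bscale ?bs" by (simp add: ordered_basis_def)
  show dimU: "U.dim (UNIV :: 'u set) = length ms"
    using U.dim_eq_card[of "set ?bs" UNIV] bs distinct_card[of ?bs] by (simp add: ordered_basis_def)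
  have mat: "op_matrix bscale ?bs [?v1, ?v2, ?v3] (f (x, y, z)) = generic_of ms x y z" for x y z
  proof (rule op_matrix_frame[OF V v])
    fix j assume j: "j < length ?bs"
    then have "ms ! j \<in> M.span (set ms)" by (simp add: M.span_base)
    then show "f (x, y, z) (?bs ! j) = comb (?v1, ?v2, ?v3) (comb (ms ! j) (x, y, z))"
      using j by (simp add: hv eq \<theta>g)
  qed simp
  have "matrix_space (generic_of ms) = op_matrix bscale ?bs [?v1, ?v2, ?v3] ` range f"
  proof -
    have "matrix_space (generic_of ms) = {op_matrix bscale ?bs [?v1, ?v2, ?v3] (f (x, y, z)) |x y z. True}"
      unfolding matrix_space_def mat ..
    also have "\<dots> = (\<lambda>c. op_matrix bscale ?bs [?v1, ?v2, ?v3] (f c)) ` UNIV"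
      by (auto simp only: image_iff split_paired_Ex) 
    finally show ?thesis by (simp only: image_image)
  qed
  moreover have "matrix_space (generic_of ms) \<subseteq> carrier_mat 3 (length ms)"
    by (auto simp: matrix_space_def generic_of_def)
  moreover have "S \<subseteq> lin_maps bscale bscale"
    using models_operator_space(1)[OF U V m] by (simp add: operator_space_def)
  ultimately show "represents bscale bscale (matrix_space (generic_of ms)) S"
    unfolding represents_def dimU dimV using bs bv(1) f(3) by blast
qed

lemma indep3_of_independent:
  assumes V: "vector_space (bscale :: bit \<Rightarrow> 'v::ab_group_add \<Rightarrow> 'v)"
    and *: "\<not> module.dependent bscale {v1, v2, v3 :: 'v}" "distinct [v1, v2, v3]"
  shows "indep3 (v1, v2, v3)"
proof -
  interpret V: vector_space "bscale :: bit \<Rightarrow> 'v \<Rightarrow> 'v" by fact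
  have "v1 \<noteq> 0" "v2 \<noteq> 0" "v3 \<noteq> 0" "v1 \<noteq> v2" "v3 \<noteq> v1" "v3 \<noteq> v2"
    using * V.dependent_zero[of "{v1, v2, v3}"] by auto
  moreover have "v3 \<noteq> v1 + v2"
  proof
    assume "v3 = v1 + v2"
    then have "v3 \<in> V.span {v1, v2}" by (simp add: V.span_add V.span_base)
    moreover have "{v1, v2, v3} - {v3} = {v1, v2}" using *(2) by auto
    ultimately have "v3 \<in> V.span ({v1, v2, v3} - {v3})" by simp
    then show False using *(1) unfolding V.dependent_def by blast
  qed
  ultimately show ?thesis by (simp add: indep3_iff[OF V])
qed

text \<open>
  Conversely, \<open>\<theta>\<close> sends the \<open>j\<close>-th vector of the given basis of \<open>U\<close> to the \<open>j\<close>-th matrix. The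
  operators defined by \<open>\<theta>\<close> have the prescribed matrices, and an operator is determined by its
  matrix, so they are exactly the members of \<open>S\<close>.
\<close>

lemma represents_models:
  assumes U: "vector_space (bscale :: bit \<Rightarrow> 'u::ab_group_add \<Rightarrow> 'u)"
    and V: "vector_space (bscale :: bit \<Rightarrow> 'v::ab_group_add \<Rightarrow> 'v)"
    and K: "singular_frame ms K"
    and rep: "represents bscale bscale (matrix_space (generic_of ms)) (S :: ('u \<Rightarrow> 'v) set)"
  shows "models (set (span_list ms)) S"
proof -
  interpret U: vector_space "bscale :: bit \<Rightarrow> 'u \<Rightarrow> 'u" by fact
  interpret V: vector_space "bscale :: bit \<Rightarrow> 'v \<Rightarrow> 'v" by fact
  interpret M: vector_space "bscale :: bit \<Rightarrow> mat3 \<Rightarrow> mat3" by (rule vector_space_mat3)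
  interpret UM: vector_space_pair "bscale :: bit \<Rightarrow> 'u \<Rightarrow> 'u" "bscale :: bit \<Rightarrow> mat3 \<Rightarrow> mat3" ..
  obtain bs cs where lin: "S \<subseteq> lin_maps bscale bscale" and bs: "ordered_basis bscale bs"
    and cs: "ordered_basis bscale cs" and M: "matrix_space (generic_of ms) = op_matrix bscale bs cs ` S"
    using rep unfolding represents_def by blast
  have "generic_of ms 0 0 0 \<in> op_matrix bscale bs cs ` S" unfolding M[symmetric] matrix_space_def by blast
  then obtain s0 where "generic_of ms 0 0 0 = op_matrix bscale bs cs s0" by blast
  then have dims: "length cs = 3" "length bs = length ms"
    by (simp_all add: op_matrix_def generic_of_def mat_eq_iff)
  then obtain v1 v2 v3 where cs3: "cs = [v1, v2, v3]"
    by (auto simp: numeral_3_eq_3 length_Suc_conv)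
  have v: "indep3 (v1, v2, v3)"
    using cs by (intro indep3_of_independent[OF V]) (auto simp: ordered_basis_def cs3)
  let ?h = "comb (v1, v2, v3)"
  have "range ?h = UNIV"
    using independent_frame(3)[OF V v] cs by (simp add: ordered_basis_def cs3)
  then have h: "additive ?h" "bij ?h"
    using additive_comb[OF V] indep3_inj[OF V v] by (auto simp: bij_def)
  have ms: "distinct ms" "M.independent (set ms)"
    using K span_list_distinctD[OF vector_space_mat3] unfolding singular_frame_def by blast+
  define pos where "pos b = (SOME j. j < length bs \<and> bs ! j = b)" for b
  have pos: "pos (bs ! j) = j" if "j < length bs" for j
    unfolding pos_def using bs that by (intro some_equality) (auto simp: ordered_basis_def nth_eq_iff_index_eq)
  obtain \<theta> where \<theta>: "Vector_Spaces.linear bscale bscale \<theta>" "\<forall>b\<in>set bs. \<theta> b = ms ! pos b"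
    using UM.linear_independent_extend[of "set bs" "\<lambda>b. ms ! pos b"] bs by (auto simp: ordered_basis_def)
  have \<theta>j: "\<theta> (bs ! j) = ms ! j" if "j < length bs" for j using \<theta>(2) pos[OF that] that by simp
  have map\<theta>: "map \<theta> bs = ms" by (rule nth_equalityI) (simp_all add: \<theta>j dims(2))
  then have ims: "\<theta> ` set bs = set ms" by (metis set_map)
  have "range \<theta> = set (span_list ms)"
    using UM.linear_span_image[OF \<theta>(1), of "set bs"] bs
    by (simp add: ims set_span_list[OF vector_space_mat3] ordered_basis_def)
  moreover have "inj \<theta>"
  proof -
    have "inj_on \<theta> (set bs)"
      using map\<theta> ms(1) by (metis distinct_map)
    then have "inj_on \<theta> (U.span (set bs))"
      using UM.linear_inj_on_span_iff_independent_image[OF \<theta>(1)] ms(2) ims by simp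
    then show ?thesis using bs by (simp add: ordered_basis_def)
  qed
  moreover have a\<theta>: "additive \<theta>" using \<theta>(1) by (simp only: linear_iff_additive[OF U vector_space_mat3])
  moreover define f where "f c u = ?h (comb (\<theta> u) c)" for c u
  have "f (c + d) = f c + f d" for c d
    by (rule ext) (simp only: f_def plus_fun_def additive.add[OF h(1)] additive.add[OF additive_comb[OF vector_space_bits]])
  then have af: "additive f" by (rule additive.intro)
  have af': "additive (f c)" for c
  proof -
    have "f c = (\<lambda>u. ?h (comb (\<theta> u) c))" by (simp add: f_def fun_eq_iff)
    moreover have "additive (\<lambda>u. comb (\<theta> u) c)" using a\<theta> by (auto simp only: additive_def comb_add_left)
    ultimately show ?thesis by (simp only: additive_comp[OF h(1)])
  qed
  have mat: "op_matrix bscale bs cs (f (x, y, z)) = generic_of ms x y z" for x y z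
    unfolding cs3 by (rule op_matrix_frame[OF V v]) (simp_all add: f_def \<theta>j dims(2) del: comb.simps)
  have S: "additive s" if "s \<in> S" for s
    using lin that by (auto simp: lin_maps_def linear_iff_additive[OF U V])
  have "range f = S"
  proof (intro subset_antisym subsetI)
    fix s assume "s \<in> range f"
    then obtain c where "s = f c" by blast
    then obtain x y z where s: "s = f (x, y, z)" by (metis prod_cases3)
    have "op_matrix bscale bs cs s \<in> op_matrix bscale bs cs ` S"
      unfolding M[symmetric] s mat matrix_space_def by blast
    then obtain t where "t \<in> S" "op_matrix bscale bs cs s = op_matrix bscale bs cs t" by blast
    then show "s \<in> S" using op_matrix_inject[OF U V bs cs, of s t] S af' s by blast
  next
    fix s assume s: "s \<in> S"
    then have "op_matrix bscale bs cs s \<in> matrix_space (generic_of ms)" unfolding M by blast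
    then obtain x y z where "op_matrix bscale bs cs s = op_matrix bscale bs cs (f (x, y, z))"
      unfolding matrix_space_def mat by blast
    then show "s \<in> range f" using op_matrix_inject[OF U V bs cs, of s "f (x, y, z)"] S[OF s] af' by blast
  qed
  moreover have "inj f"
    unfolding additive_inj_iff[OF af]
  proof (intro allI impI)
    fix c assume "f c = 0"
    then have "?h (comb (\<theta> u) c) = 0" for u by (metis f_def zero_fun_def)
    then have "comb (\<theta> u) c = 0" for u
      using h additive_inj_iff[OF h(1)] unfolding bij_def by blast
    then have 0: "comb m c = 0" if "m \<in> set (span_list ms)" for m
      using that unfolding \<open>range \<theta> = set (span_list ms)\<close>[symmetric] by (elim rangeE) simp
    then show "c = 0" using singular_frame_nondegenerate[OF K] by blast
  qed
  ultimately show ?thesis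
    unfolding models_def using af h f_def by blast
qed

lemma exists_models:
  assumes U: "vector_space (bscale :: bit \<Rightarrow> 'u::ab_group_add \<Rightarrow> 'u)"
    and V: "vector_space (bscale :: bit \<Rightarrow> 'v::ab_group_add \<Rightarrow> 'v)"
    and dist: "distinct (span_list ms)"
    and frame: "\<And>c. \<forall>m\<in>set (span_list ms). comb m c = 0 \<Longrightarrow> c = 0"
    and dimU: "vector_space.dim bscale (UNIV :: 'u set) = length ms" "length ms > 0"
    and dimV: "vector_space.dim bscale (UNIV :: 'v set) = 3"
  shows "\<exists>S :: ('u \<Rightarrow> 'v) set. models (set (span_list ms)) S"
proof -
  interpret U: vector_space "bscale :: bit \<Rightarrow> 'u \<Rightarrow> 'u" by fact
  interpret V: vector_space "bscale :: bit \<Rightarrow> 'v \<Rightarrow> 'v" by fact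
  interpret M: vector_space "bscale :: bit \<Rightarrow> mat3 \<Rightarrow> mat3" by (rule vector_space_mat3)
  interpret B: vector_space "bscale :: bit \<Rightarrow> bits \<Rightarrow> bits" by (rule vector_space_bits)
  interpret UM: vector_space_pair "bscale :: bit \<Rightarrow> 'u \<Rightarrow> 'u" "bscale :: bit \<Rightarrow> mat3 \<Rightarrow> mat3" ..
  interpret BV: vector_space_pair "bscale :: bit \<Rightarrow> bits \<Rightarrow> bits" "bscale :: bit \<Rightarrow> 'v \<Rightarrow> 'v" ..
  have ms: "distinct ms" "M.independent (set ms)"
    using span_list_distinctD[OF vector_space_mat3 dist] by blast+
  obtain B where B: "U.independent B" "UNIV \<subseteq> U.span B" "card B = length ms"
    using U.basis_exists[of UNIV] dimU(1) by metis
  have "finite B" using B(3) dimU(2) card_ge_0_finite by metis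
  moreover have "M.dim (M.span (set ms)) = length ms"
    using ms by (simp add: M.dim_eq_card_independent distinct_card)
  ultimately have "\<exists>\<theta>. Vector_Spaces.linear bscale bscale \<theta> \<and> \<theta> ` B = set ms \<and>
      \<theta> ` (UNIV :: 'u set) = M.span (set ms) \<and> inj_on \<theta> UNIV"
    using B ms dimU(1) M.span_superset
    by (intro UM.finite_basis_to_basis_subspace_isomorphism) (auto simp: distinct_card)
  then obtain \<theta> :: "'u \<Rightarrow> mat3" where
    th: "Vector_Spaces.linear bscale bscale \<theta>" "range \<theta> = M.span (set ms)" "inj \<theta>" by blast
  obtain C where C: "V.independent C" "UNIV \<subseteq> V.span C" "card C = 3"
    using V.basis_exists[of UNIV] dimV by metis
  then obtain v1 v2 v3 where c: "C = {v1, v2, v3}" "distinct [v1, v2, v3]" by (auto simp: card_3_iff)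
  have v: "indep3 (v1, v2, v3)"
    using C(1) c unfolding c(1) by (intro indep3_of_independent[OF V]) auto
  let ?h = "comb (v1, v2, v3)"
  have h: "additive ?h" "bij ?h"
    using additive_comb[OF V] indep3_inj[OF V v] independent_frame(3)[OF V v] C(2) c(1) by (auto simp: bij_def)
  have a\<theta>: "additive \<theta>" using th(1) by (simp only: linear_iff_additive[OF U vector_space_mat3])
  define f where "f c u = ?h (comb (\<theta> u) c)" for c u
  have "f (c + d) = f c + f d" for c d
    by (rule ext) (simp only: f_def plus_fun_def additive.add[OF h(1)] additive.add[OF additive_comb[OF vector_space_bits]])
  then have af: "additive f" by (rule additive.intro)
  have "inj f"
    unfolding additive_inj_iff[OF af]
  proof (intro allI impI)
    fix c assume "f c = 0"
    then have "?h (comb (\<theta> u) c) = 0" for u by (metis f_def zero_fun_def)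
    then have "comb (\<theta> u) c = 0" for u
      using h additive_inj_iff[OF h(1)] unfolding bij_def by blast
    then have "\<forall>m\<in>range \<theta>. comb m c = 0" by (metis rangeE)
    then show "c = 0" using frame[of c] unfolding th(2) set_span_list[OF vector_space_mat3] by blast
  qed
  then have "models (set (span_list ms)) (range f)"
    unfolding models_def set_span_list[OF vector_space_mat3] using af h a\<theta> th(2,3) f_def by blast
  then show ?thesis by blast
qed

section \<open>Spaces of singular matrices that contain two diagonal matrices\<close>

definition all_columns :: "mat3 list list" where
  "all_columns = columns_b # columns_c @ columns_d @ [columns_e]"

definition diag1 :: mat3 where "diag1 = ((1, 0, 0), (0, 1, 0), (0, 0, 0))"
definition diag2 :: mat3 where "diag2 = ((0, 0, 0), (0, 1, 0), (0, 0, 1))"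

text \<open>
  Matrices with zero diagonal are read as digraphs on three vertices, with an edge for each nonzero
  entry: the first triple holds the entries above the diagonal, at the positions 12, 13 and 23,
  and the second triple holds the transposed positions.
\<close>

fun off_diagonal :: "bits \<times> bits \<Rightarrow> mat3" where
  "off_diagonal ((u12, u13, u23), (l21, l31, l32)) = ((0, l21, l31), (u12, 0, l32), (u13, u23, 0))"

definition equivalent_by :: "mat3 \<Rightarrow> mat3 \<Rightarrow> mat3 list \<Rightarrow> mat3 list \<Rightarrow> bool" where
  "equivalent_by P Q ms ns \<longleftrightarrow>
     (\<forall>c\<in>set all_bits. comb P c = 0 \<longrightarrow> c = 0) \<and> (\<forall>c\<in>set all_bits. comb Q c = 0 \<longrightarrow> c = 0) \<and>
     set (map (\<lambda>m. mult3 P (mult3 m Q)) (span_list ms)) = set (span_list ns)"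

lemma equivalent_byD:
  assumes "equivalent_by P Q ms ns"
  shows "equivalent (set (span_list ms)) (set (span_list ns))"
  unfolding equivalent_def
proof (intro exI conjI)
  show "indep3 P" "indep3 Q" "(\<lambda>m. mult3 P (mult3 m Q)) ` set (span_list ms) = set (span_list ns)"
    subgoal using assms unfolding equivalent_by_def indep3_def set_all_bits by (elim conjE) (rule allI, erule bspec, rule UNIV_I)
    subgoal using assms unfolding equivalent_by_def indep3_def set_all_bits by (elim conjE) (rule allI, erule bspec, rule UNIV_I)
    subgoal using assms unfolding equivalent_by_def set_map by (elim conjE)
    done
qed

definition diagonal_plus :: "(bits \<times> bits) list \<Rightarrow> mat3 list" where
  "diagonal_plus ps = diag1 # diag2 # map off_diagonal ps"

text \<open>
  Each entry consists of a basis of a subspace of the strictly upper triangular matrices, the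
  position in \<open>all_columns\<close> of a listed space, and matrices \<open>P\<close> and \<open>Q\<close> that carry the sum of the
  subspace and the diagonal matrices onto the listed space. The bases run through all sixteen
  subspaces (\<open>bits_subspaces\<close>).
\<close>

definition triangular_reductions :: "(bits list \<times> nat \<times> mat3 \<times> mat3) list" where
  "triangular_reductions =
   [([], 0, ((0, 0, 1), (0, 1, 0), (1, 0, 0)), ((0, 0, 1), (0, 1, 0), (1, 0, 0))),
    ([(0, 0, 1)], 3, ((0, 1, 0), (1, 0, 0), (0, 0, 1)), ((0, 1, 0), (1, 0, 0), (0, 0, 1))),
    ([(0, 1, 0)], 3, ((1, 0, 0), (0, 1, 0), (0, 0, 1)), ((1, 0, 0), (0, 1, 0), (0, 0, 1))),
    ([(0, 1, 1)], 5, ((1, 0, 0), (1, 1, 0), (0, 0, 1)), ((1, 0, 0), (1, 1, 0), (0, 0, 1))),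
    ([(1, 0, 0)], 3, ((1, 0, 0), (0, 0, 1), (0, 1, 0)), ((1, 0, 0), (0, 0, 1), (0, 1, 0))),
    ([(1, 0, 1)], 6, ((1, 0, 0), (0, 1, 0), (0, 0, 1)), ((1, 0, 0), (0, 1, 0), (0, 0, 1))),
    ([(1, 1, 0)], 4, ((1, 0, 0), (0, 1, 0), (0, 1, 1)), ((1, 0, 0), (0, 1, 0), (0, 1, 1))),
    ([(1, 1, 1)], 6, ((1, 0, 0), (0, 1, 0), (0, 1, 1)), ((1, 0, 0), (1, 1, 0), (0, 1, 1))),
    ([(0, 0, 1), (0, 1, 0)], 9, ((0, 1, 0), (1, 0, 0), (0, 0, 1)), ((0, 1, 0), (1, 0, 0), (0, 0, 1))),
    ([(0, 0, 1), (1, 0, 0)], 7, ((1, 0, 0), (0, 1, 0), (0, 0, 1)), ((1, 0, 0), (0, 1, 0), (0, 0, 1))),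
    ([(0, 0, 1), (1, 1, 0)], 7, ((1, 0, 0), (0, 1, 0), (0, 0, 1)), ((1, 0, 0), (0, 1, 0), (0, 1, 1))),
    ([(0, 1, 0), (1, 0, 0)], 8, ((1, 0, 0), (0, 0, 1), (0, 1, 0)), ((1, 0, 0), (0, 0, 1), (0, 1, 0))),
    ([(0, 1, 0), (1, 0, 1)], 10, ((1, 0, 0), (0, 1, 0), (0, 0, 1)), ((1, 0, 0), (0, 1, 0), (0, 0, 1))),
    ([(0, 1, 1), (1, 0, 0)], 7, ((1, 0, 0), (1, 1, 0), (0, 0, 1)), ((1, 0, 0), (0, 1, 0), (0, 0, 1))),
    ([(0, 1, 1), (1, 0, 1)], 7, ((1, 0, 0), (1, 1, 0), (1, 0, 1)), ((1, 0, 0), (0, 1, 0), (1, 1, 1))),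
    ([(0, 0, 1), (0, 1, 0), (1, 0, 0)], 12, ((1, 0, 0), (0, 1, 0), (0, 0, 1)), ((1, 0, 0), (0, 1, 0), (0, 0, 1)))]"

text \<open>
  The same data for the spaces that no permutation makes triangular: those that contain the
  all-ones matrix off the diagonal, and the even-weight spaces on the two cyclic tournaments.
\<close>

definition cyclic_reductions :: "((bits \<times> bits) list \<times> nat \<times> mat3 \<times> mat3) list" where
  "cyclic_reductions =
   [([((1, 1, 1), (1, 1, 1))], 2, ((0, 1, 0), (0, 1, 1), (1, 0, 0)), ((0, 1, 1), (1, 1, 0), (0, 0, 1))),
    ([((1, 1, 1), (1, 1, 1)), ((0, 0, 0), (1, 1, 1))], 11, ((0, 0, 1), (0, 1, 0), (1, 1, 0)), ((1, 1, 0), (1, 0, 0), (0, 1, 1))),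
    ([((1, 1, 1), (1, 1, 1)), ((0, 0, 1), (1, 1, 0))], 11, ((0, 0, 1), (1, 1, 0), (0, 1, 0)), ((1, 0, 1), (1, 0, 0), (0, 1, 1))),
    ([((1, 1, 1), (1, 1, 1)), ((0, 1, 1), (1, 0, 0))], 11, ((0, 0, 1), (0, 1, 0), (1, 0, 1)), ((1, 1, 0), (1, 0, 1), (0, 1, 0))),
    ([((1, 1, 1), (1, 1, 1)), ((1, 0, 0), (0, 1, 1))], 11, ((0, 0, 1), (0, 1, 0), (1, 0, 1)), ((1, 1, 0), (1, 0, 1), (0, 1, 0))),
    ([((1, 1, 1), (1, 1, 1)), ((1, 1, 0), (0, 0, 1))], 11, ((0, 0, 1), (1, 1, 0), (0, 1, 0)), ((1, 0, 1), (1, 0, 0), (0, 1, 1))),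
    ([((1, 1, 1), (1, 1, 1)), ((1, 1, 1), (0, 0, 0))], 11, ((0, 0, 1), (0, 1, 0), (1, 1, 0)), ((1, 1, 0), (1, 0, 0), (0, 1, 1))),
    ([((1, 0, 0), (0, 1, 0)), ((1, 0, 1), (0, 0, 0))], 11, ((0, 0, 1), (0, 1, 0), (1, 0, 0)), ((0, 1, 0), (1, 0, 0), (0, 0, 1))),
    ([((0, 1, 0), (1, 0, 0)), ((0, 0, 0), (1, 0, 1))], 11, ((0, 0, 1), (0, 1, 0), (1, 0, 0)), ((1, 0, 0), (0, 0, 1), (0, 1, 0)))]"

lemma triangular_reductions_correct:
  "\<forall>(bs, i, P, Q)\<in>set triangular_reductions. i < length all_columns \<and>
     equivalent_by P Q (diagonal_plus (map (\<lambda>b. (b, 0)) bs)) (all_columns ! i)"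
  by code_simp

lemma cyclic_reductions_correct:
  "\<forall>(ps, i, P, Q)\<in>set cyclic_reductions. i < length all_columns \<and>
     equivalent_by P Q (diagonal_plus ps) (all_columns ! i)"
  by code_simp

lemma bits_subspaces:
  "\<forall>xs\<in>set (subseqs all_bits). 0 \<in> set xs \<longrightarrow> (\<forall>x\<in>set xs. \<forall>y\<in>set xs. x + y \<in> set xs) \<longrightarrow>
     (\<exists>bs\<in>set (map fst triangular_reductions). set (span_list bs) = set xs)"
  by code_simp

lemma subspace_of_bits:
  assumes "0 \<in> M" "\<And>x y. x \<in> M \<Longrightarrow> y \<in> M \<Longrightarrow> x + y \<in> M"
  shows "\<exists>bs\<in>set (map fst triangular_reductions). set (span_list bs) = M"
proof -
  have "M \<in> set ` set (subseqs all_bits)" unfolding subseqs_powset set_all_bits by simp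
  then obtain xs where "xs \<in> set (subseqs all_bits)" "M = set xs" by blast
  then show ?thesis using bits_subspaces assms by blast
qed

text \<open>
  The products over the three pairs of opposite edges are equal. If they are zero, there is no
  2-cycle, and the two 3-cycles cannot occur together, so that the last equation excludes both.
  If they are one, all six edges are present.
\<close>

fun acyclic_or_full :: "bits \<times> bits \<Rightarrow> bool" where
  "acyclic_or_full ((u12, u13, u23), (l21, l31, l32)) \<longleftrightarrow>
     u12 * l21 = u13 * l31 \<and> u23 * l32 = u13 * l31 \<and> u12 * u23 * l31 = u13 * l21 * l32"

definition singular :: "mat3 \<Rightarrow> bool" where
  "singular m \<longleftrightarrow> (\<exists>c\<in>set all_bits. c \<noteq> 0 \<and> comb m c = 0)"

text \<open>
  The diagonal of a matrix can be shifted by the two diagonal matrices, so that it becomes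
  \<open>(0, t, 0)\<close>, where \<open>t\<close> is the trace. Singularity of all four shifts of the result forces \<open>t = 0\<close>
  and the condition on the digraph.
\<close>

lemma singular_shifts:
  "\<forall>u\<in>set all_bits. \<forall>l\<in>set all_bits. \<forall>t\<in>set [0, 1].
     (let m = off_diagonal (u, l) + ((0, 0, 0), (0, t, 0), (0, 0, 0)) in
      singular m \<and> singular (m + diag1) \<and> singular (m + diag2) \<and> singular (m + (diag1 + diag2)) \<longrightarrow>
      t = 0 \<and> acyclic_or_full (u, l))"
  by code_simp

text \<open>
  These three facts apply to the minors of a matrix with an additional row, in which this row takes
  the place of one of the three rows. The diagonal entries of the other two rows can be
  shifted independently; if all four shifts are singular, the additional row has a zero at the
  diagonal position that it occupies, as this entry is the coefficient of the product of the shifts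
  in the determinant.
\<close>

lemma singular_minor1:
  "\<forall>a\<in>set all_bits. \<forall>b\<in>set all_bits. \<forall>c\<in>set all_bits.
     (\<forall>p\<in>set [0, 1]. \<forall>q\<in>set [0, 1]. singular (a, b + (0, p, 0), c + (0, 0, q))) \<longrightarrow> fst a = 0"
  by code_simp

lemma singular_minor2:
  "\<forall>a\<in>set all_bits. \<forall>b\<in>set all_bits. \<forall>c\<in>set all_bits.
     (\<forall>p\<in>set [0, 1]. \<forall>q\<in>set [0, 1]. singular (a + (p, 0, 0), b, c + (0, 0, q))) \<longrightarrow> fst (snd b) = 0"
  by code_simp

lemma singular_minor3:
  "\<forall>a\<in>set all_bits. \<forall>b\<in>set all_bits. \<forall>c\<in>set all_bits.
     (\<forall>p\<in>set [0, 1]. \<forall>q\<in>set [0, 1]. singular (a + (p, 0, 0), b + (0, q, 0), c)) \<longrightarrow> snd (snd c) = 0"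
  by code_simp

text \<open>
  The digraph with support in the tournament \<open>w\<close> and edge set \<open>x\<close>: the pairs of vertices are taken in
  the order 12, 13, 23, and a one in \<open>w\<close> orients the pair upwards. The tournaments \<open>(1, 0, 1)\<close>
  and \<open>(0, 1, 0)\<close> are the cyclic ones.
\<close>

fun orient :: "bits \<Rightarrow> bits \<Rightarrow> bits \<times> bits" where
  "orient (o1, o2, o3) (x1, x2, x3) =
     ((o1 * x1, o2 * x2, o3 * x3), ((1 + o1) * x1, (1 + o2) * x2, (1 + o3) * x3))"

text \<open>
  The substitution \<open>m \<mapsto> P m Q\<close> preserves the span of the two diagonal matrices and makes all digraphs
  inside the tournament \<open>w\<close> strictly upper triangular.
\<close>

definition triangulates :: "mat3 \<Rightarrow> mat3 \<Rightarrow> bits \<Rightarrow> bool" where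
  "triangulates P Q w \<longleftrightarrow>
     (\<forall>c\<in>set all_bits. comb P c = 0 \<longrightarrow> c = 0) \<and> (\<forall>c\<in>set all_bits. comb Q c = 0 \<longrightarrow> c = 0) \<and>
     (\<forall>d\<in>set [diag1, diag2]. mult3 P (mult3 d Q) \<in> set (span_list [diag1, diag2])) \<and>
     (\<forall>d\<in>set [diag1, diag2]. \<exists>d'\<in>set (span_list [diag1, diag2]). mult3 P (mult3 d' Q) = d) \<and>
     (\<forall>x\<in>set all_bits. \<exists>y\<in>set all_bits. mult3 P (mult3 (off_diagonal (orient w x)) Q) = off_diagonal (y, 0))"

definition permutations3 :: "(mat3 \<times> mat3) list" where
  "permutations3 =
   [(((1,0,0), (0,1,0), (0,0,1)), ((1,0,0), (0,1,0), (0,0,1))),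
    (((0,1,0), (1,0,0), (0,0,1)), ((0,1,0), (1,0,0), (0,0,1))),
    (((0,0,1), (0,1,0), (1,0,0)), ((0,0,1), (0,1,0), (1,0,0))),
    (((1,0,0), (0,0,1), (0,1,0)), ((1,0,0), (0,0,1), (0,1,0))),
    (((0,1,0), (0,0,1), (1,0,0)), ((0,0,1), (1,0,0), (0,1,0))),
    (((0,0,1), (1,0,0), (0,1,0)), ((0,1,0), (0,0,1), (1,0,0)))]"

text \<open>
  A transitive tournament is a linear order of the vertices, and the permutation matrix that sorts
  them makes it upper triangular.
\<close>

lemma transitive_orientations:
  "\<forall>w\<in>set all_bits. w \<noteq> (1, 0, 1) \<longrightarrow> w \<noteq> (0, 1, 0) \<longrightarrow>
     (\<exists>(P, Q)\<in>set permutations3. triangulates P Q w)"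
  by code_simp

text \<open>
  On a cyclic tournament the full triangle is forbidden. A subspace that omits it and is not
  supported on two edges is the space of vectors of even weight.
\<close>

lemma even_weight_unique:
  "\<forall>bs\<in>set (map fst triangular_reductions).
     (1, 1, 1) \<notin> set (span_list bs) \<longrightarrow> (\<exists>x\<in>set (span_list bs). fst x = 1) \<longrightarrow>
     (\<exists>x\<in>set (span_list bs). fst (snd x) = 1) \<longrightarrow> (\<exists>x\<in>set (span_list bs). snd (snd x) = 1) \<longrightarrow>
     set (span_list bs) = set (span_list [(1, 1, 0), (1, 0, 1)])"
  by code_simp

definition full :: "bits \<times> bits" where "full = ((1, 1, 1), (1, 1, 1))"

definition tournaments :: "(bits \<times> bits) list" where
  "tournaments = map (\<lambda>w. orient w (1, 1, 1)) (filter (\<lambda>w. w \<noteq> (1, 0, 1) \<and> w \<noteq> (0, 1, 0)) all_bits)"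

text \<open>
  If the all-ones digraph belongs to the space, each member has a complement in the space. Two
  complementary acyclic digraphs form a pair of opposite transitive tournaments.
\<close>

lemma complementary_digraphs:
  "\<forall>u\<in>set all_bits. \<forall>l\<in>set all_bits.
     acyclic_or_full (u, l) \<longrightarrow> acyclic_or_full ((u, l) + full) \<longrightarrow>
     (u, l) \<in> set ([0, full] @ tournaments)"
  by code_simp

lemma complementary_pairs:
  "\<forall>p\<in>set tournaments. \<forall>q\<in>set tournaments.
     p + q \<in> set ([0, full] @ tournaments) \<longrightarrow> q = p \<or> q = p + full"
  by code_simp

lemma no_antiparallel_edges:
  "\<forall>u\<in>set all_bits. \<forall>l\<in>set all_bits. acyclic_or_full (u, l) \<longrightarrow> (u, l) \<noteq> full \<longrightarrow>
     fst l * fst u = 0 \<and> fst (snd l) * fst (snd u) = 0 \<and> snd (snd l) * snd (snd u) = 0"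
  by code_simp

lemma cyclic_cases:
  "[full] \<in> set (map fst cyclic_reductions)"
  "\<forall>p\<in>set tournaments. [full, p] \<in> set (map fst cyclic_reductions)"
  "\<forall>w\<in>set [(1, 0, 1), (0, 1, 0)]. map (orient w) [(1, 1, 0), (1, 0, 1)] \<in> set (map fst cyclic_reductions)"
  by code_simp+

lemma additive_off_diagonal: "additive off_diagonal"
proof
  fix p q :: "bits \<times> bits"
  show "off_diagonal (p + q) = off_diagonal p + off_diagonal q"
    by (cases p rule: off_diagonal.cases; cases q rule: off_diagonal.cases) (simp only: add_Pair off_diagonal.simps add_0)
qed

lemma additive_orient: "additive (orient w)"
proof
  fix p q :: bits
  obtain a b c a' b' c' o1 o2 o3 where "p = (a, b, c)" "q = (a', b', c')" "w = (o1, o2, o3)" by (metis prod_cases3)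
  then show "orient w (p + q) = orient w p + orient w q"
    by (simp only: add_Pair orient.simps distrib_left)
qed

lemma set_span_list_map:
  assumes "additive g"
  shows "set (span_list (map g xs)) = g ` set (span_list xs)"
proof (induction xs)
  case Nil then show ?case using additive.zero[OF assms] by simp
next
  case (Cons x xs)
  then show ?case by (simp only: list.map span_list.simps set_append set_map image_Un image_image additive.add[OF assms])
qed

lemma models_additive:
  assumes "models D (S :: ('u::ab_group_add \<Rightarrow> 'v::ab_group_add) set)"
  shows "0 \<in> D" "m \<in> D \<Longrightarrow> n \<in> D \<Longrightarrow> m + n \<in> D"
proof -
  obtain \<theta> :: "'u \<Rightarrow> mat3" where \<theta>: "additive \<theta>" "range \<theta> = D"
    using assms unfolding models_def by (elim exE conjE)
  show "0 \<in> D" unfolding \<theta>(2)[symmetric] additive.zero[OF \<theta>(1), symmetric] by (rule rangeI)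
  show "m + n \<in> D" if mn: "m \<in> D" "n \<in> D"
  proof -
    obtain u w where "m = \<theta> u" "n = \<theta> w" using mn unfolding \<theta>(2)[symmetric] by (elim rangeE)
    then show ?thesis unfolding \<theta>(2)[symmetric] by (simp only: additive.add[OF \<theta>(1), symmetric] rangeI)
  qed
qed

definition digraphs :: "mat3 set \<Rightarrow> (bits \<times> bits) set" where
  "digraphs D = {p. off_diagonal p \<in> D}"

lemma digraphs_additive:
  assumes "models D S"
  shows "0 \<in> digraphs D" "p \<in> digraphs D \<Longrightarrow> q \<in> digraphs D \<Longrightarrow> p + q \<in> digraphs D"
  using models_additive[OF assms] additive.zero[OF additive_off_diagonal] additive.add[OF additive_off_diagonal]
  unfolding digraphs_def by simp_all

lemma digraphs_orient_additive:
  assumes "models D S"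
  shows "0 \<in> {x. orient w x \<in> digraphs D}"
    "x \<in> {x. orient w x \<in> digraphs D} \<Longrightarrow> y \<in> {x. orient w x \<in> digraphs D} \<Longrightarrow> x + y \<in> {x. orient w x \<in> digraphs D}"
  using digraphs_additive[OF assms] additive.zero[OF additive_orient] additive.add[OF additive_orient]
  by simp_all

text \<open>
  Subtracting combinations of the two diagonal matrices from a member brings its diagonal to
  \<open>(0, t, 0)\<close>. Since all shifts of it stay in the space, \<open>singular_shifts\<close> applies.
\<close>

lemma diagonal_decomposition:
  assumes D: "models D S" "diag1 \<in> D" "diag2 \<in> D" and sing: "\<forall>m\<in>D. singular m"
  shows "\<forall>p\<in>digraphs D. acyclic_or_full p"
    and "D = {d + off_diagonal p |d p. d \<in> set (span_list [diag1, diag2]) \<and> p \<in> digraphs D}"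
proof -
  have add: "m + n \<in> D" if "m \<in> D" "n \<in> D" for m n by (rule models_additive(2)[OF D(1) that])
  have key: "t = 0 \<and> acyclic_or_full (u, l)" if m: "off_diagonal (u, l) + ((0, 0, 0), (0, t, 0), (0, 0, 0)) \<in> D" for u l t
  proof -
    let ?m = "off_diagonal (u, l) + ((0, 0, 0), (0, t, 0), (0, 0, 0))"
    have "singular ?m" "singular (?m + diag1)" "singular (?m + diag2)" "singular (?m + (diag1 + diag2))"
      using sing add m D(2,3) by blast+
    moreover have "t \<in> set [0, 1]" by (cases t) simp_all
    ultimately show ?thesis using singular_shifts unfolding set_all_bits Let_def by blast
  qed
  show "\<forall>p\<in>digraphs D. acyclic_or_full p"
  proof
    fix p assume "p \<in> digraphs D"
    then have "off_diagonal (fst p, snd p) + ((0, 0, 0), (0, 0, 0), (0, 0, 0)) \<in> D"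
      by (simp add: digraphs_def flip: zero_prod_def)
    from key[OF this] show "acyclic_or_full p" by simp
  qed
  have span: "d \<in> D" if "d \<in> set (span_list [diag1, diag2])" for d
    using that D(2,3) add[OF D(2,3)] models_additive(1)[OF D(1)] by auto
  show "D = {d + off_diagonal p |d p. d \<in> set (span_list [diag1, diag2]) \<and> p \<in> digraphs D}" (is "_ = ?R")
  proof (intro subset_antisym subsetI)
    fix m assume "m \<in> ?R" then show "m \<in> D" using add span unfolding digraphs_def by blast
  next
    fix m assume m: "m \<in> D"
    obtain a1 a2 a3 b1 b2 b3 c1 c2 c3 where m_eq: "m = ((a1, a2, a3), (b1, b2, b3), (c1, c2, c3))"
      by (metis prod_cases3)
    define d where "d = bscale a1 diag1 + bscale c3 diag2"
    have d: "d \<in> set (span_list [diag1, diag2])"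
      unfolding d_def by (cases a1; cases c3) (simp_all add: add.commute)
    let ?p = "((b1, c1, c2), (a2, a3, b3))"
    have "m + d = off_diagonal ?p + ((0, 0, 0), (0, a1 + b2 + c3, 0), (0, 0, 0))"
      unfolding d_def m_eq diag1_def diag2_def
      by (cases a1; cases c3; cases b2) simp_all
    moreover have "m + d \<in> D" using add m span d by blast
    ultimately have in_D: "off_diagonal ?p + ((0, 0, 0), (0, a1 + b2 + c3, 0), (0, 0, 0)) \<in> D" by simp
    from key[OF this] have t: "a1 + b2 + c3 = 0" by blast
    have "?p \<in> digraphs D" using in_D unfolding digraphs_def t by (simp flip: zero_prod_def)
    moreover have "m = d + off_diagonal ?p"
      unfolding d_def m_eq diag1_def diag2_def using t
      by (cases a1; cases c3; cases b2) simp_all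
    ultimately show "m \<in> ?R" using d by blast
  qed
qed

lemma span_list_two_more:
  "set (span_list (a # b # ms)) = {d + m |d m. d \<in> set (span_list [a, b]) \<and> m \<in> set (span_list ms)}"
  by (simp add: image_Un image_image) (auto simp: image_iff add.assoc, metis add_0_left, metis add.assoc)

lemma span_diagonal_plus:
  "set (span_list (diagonal_plus ps)) =
     {d + off_diagonal p |d p. d \<in> set (span_list [diag1, diag2]) \<and> p \<in> set (span_list ps)}"
proof -
  have image: "{d + m |d m. d \<in> A \<and> m \<in> f ` B} = {d + f p |d p. d \<in> A \<and> p \<in> B}"
    for A :: "'b::plus set" and f :: "'c \<Rightarrow> 'b" and B by blast
  have "set (span_list (diagonal_plus ps)) =
      {d + m |d m. d \<in> set (span_list [diag1, diag2]) \<and> m \<in> set (span_list (map off_diagonal ps))}"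
    unfolding diagonal_plus_def by (rule span_list_two_more)
  then show ?thesis unfolding set_span_list_map[OF additive_off_diagonal] image .
qed

lemma reduced_cases:
  assumes D: "models D S" "diag1 \<in> D" "diag2 \<in> D" and sing: "\<forall>m\<in>D. singular m"
    and N: "digraphs D = set (span_list ps)"
    and ps: "ps \<in> set (map fst cyclic_reductions) \<or> (\<exists>bs. ps = map (\<lambda>b. (b, 0)) bs \<and> bs \<in> set (map fst triangular_reductions))"
  shows "\<exists>ns\<in>set all_columns. models (set (span_list ns)) S"
proof -
  have "D = set (span_list (diagonal_plus ps))"
    using diagonal_decomposition(2)[OF D sing] unfolding span_diagonal_plus N .
  moreover obtain i P Q where "i < length all_columns" "equivalent_by P Q (diagonal_plus ps) (all_columns ! i)"
    using ps triangular_reductions_correct cyclic_reductions_correct by fastforce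
  ultimately show ?thesis
    using models_equivalent[OF D(1)] equivalent_byD nth_mem by metis
qed

lemma classify_triangular:
  assumes D: "models D S" "diag1 \<in> D" "diag2 \<in> D" and sing: "\<forall>m\<in>D. singular m"
    and upper: "\<forall>p\<in>digraphs D. snd p = 0"
  shows "\<exists>ns\<in>set all_columns. models (set (span_list ns)) S"
proof -
  let ?M = "{b. (b, 0) \<in> digraphs D}"
  have "0 \<in> ?M" using digraphs_additive(1)[OF D(1)] by (simp add: zero_prod_def[where 'a = bits and 'b = bits])
  moreover have "x + y \<in> ?M" if "x \<in> ?M" "y \<in> ?M" for x y
  proof -
    have "(x, 0) + (y, 0) \<in> digraphs D" using that digraphs_additive(2)[OF D(1)] by blast
    then show ?thesis by (simp only: add_Pair add_0 mem_Collect_eq)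
  qed
  ultimately obtain bs where bs: "bs \<in> set (map fst triangular_reductions)" "set (span_list bs) = ?M"
    using subspace_of_bits[of ?M] by blast
  have "additive (\<lambda>b :: bits. (b, 0 :: bits))" by standard (simp only: add_Pair add_0)
  then have "set (span_list (map (\<lambda>b. (b, 0 :: bits)) bs)) = (\<lambda>b. (b, 0)) ` ?M"
    by (simp only: set_span_list_map bs(2))
  also have "\<dots> = digraphs D" using upper by (force simp del: split_paired_All)
  finally show ?thesis
    using reduced_cases[OF D sing, of "map (\<lambda>b. (b, 0)) bs"] bs(1) by blast
qed

text \<open>
  After the permutation that sorts the tournament, all digraphs of the space are upper triangular and
  the diagonal matrices are still present.
\<close>

lemma classify_oriented:
  assumes D: "models D S" "diag1 \<in> D" "diag2 \<in> D" and sing: "\<forall>m\<in>D. singular m"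
    and w: "\<forall>p\<in>digraphs D. \<exists>x. p = orient w x" and trans: "w \<noteq> (1, 0, 1)" "w \<noteq> (0, 1, 0)"
  shows "\<exists>ns\<in>set all_columns. models (set (span_list ns)) S"
proof -
  obtain P Q where "triangulates P Q w"
    using transitive_orientations trans unfolding set_all_bits by blast
  note tri = this[unfolded triangulates_def set_all_bits]
  define T where "T m = mult3 P (mult3 m Q)" for m
  have T_eq: "T = (\<lambda>m. mult3 P (mult3 m Q))" by (rule ext) (simp only: T_def)
  have aT: "additive T" unfolding T_eq
    by (rule additive_comp[OF additive_mult3_left additive_mult3_right])
  have span: "d \<in> D" if "d \<in> set (span_list [diag1, diag2])" for d
    using that D(2,3) models_additive(2)[OF D(1) D(2,3)] models_additive(1)[OF D(1)] by auto
  have PQ: "indep3 P" "indep3 Q" using tri unfolding indep3_def by blast+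
  have D': "models (T ` D) S"
    using models_equivalent[OF D(1)] PQ unfolding equivalent_def T_eq by blast
  have diag: "diag1 \<in> T ` D" "diag2 \<in> T ` D"
    using tri span unfolding T_eq by (simp_all del: mult3.simps span_list.simps) (metis image_eqI)+
  have sing': "\<forall>m\<in>T ` D. singular m"
  proof
    fix m assume "m \<in> T ` D"
    then obtain n where n: "m = T n" "n \<in> D" by blast
    then obtain c where c: "c \<noteq> 0" "comb n c = 0" using sing unfolding singular_def by blast
    obtain c' where c': "c = comb Q c'" using indep3_bij[OF PQ(2)] by (metis bij_pointE)
    have "comb m c' = 0" using c(2) unfolding n(1) T_def comb_mult3 c'[symmetric] by simp
    moreover have "c' \<noteq> 0" using c(1) c' by auto
    ultimately show "singular m" unfolding singular_def set_all_bits by blast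
  qed
  have "snd p = 0" if p: "p \<in> digraphs (T ` D)" for p
  proof -
    obtain m where m: "m \<in> D" "off_diagonal p = T m" using p unfolding digraphs_def by blast
    obtain d q where q: "m = d + off_diagonal q" "d \<in> set (span_list [diag1, diag2])" "q \<in> digraphs D"
      using m(1) diagonal_decomposition(2)[OF D sing] by blast
    obtain x where "q = orient w x" using w q(3) by blast
    then obtain y where y: "T (off_diagonal q) = off_diagonal (y, 0)" using tri unfolding T_def by blast
    have "T d \<in> set (span_list [diag1, diag2])"
    proof -
      have "T diag1 \<in> set (span_list [diag1, diag2])" "T diag2 \<in> set (span_list [diag1, diag2])"
        using tri unfolding T_def by simp_all
      moreover have "e + e' \<in> set (span_list [diag1, diag2])"
        if "e \<in> set (span_list [diag1, diag2])" "e' \<in> set (span_list [diag1, diag2])" for e e'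
        using that
        by (simp add: set_span_list[OF vector_space_mat3] module.span_add[OF vector_space_mat3[unfolded module_iff_vector_space[symmetric]]] del: span_list.simps)
      moreover have "d = 0 \<or> d = diag1 \<or> d = diag2 \<or> d = diag1 + diag2" using q(2) by auto
      moreover have "0 \<in> set (span_list [diag1, diag2])" by simp
      ultimately show ?thesis using additive.add[OF aT] additive.zero[OF aT] by metis
    qed
    moreover have "off_diagonal p = T d + off_diagonal (y, 0)"
      unfolding m(2) q(1) additive.add[OF aT] y ..
    ultimately show ?thesis
      by (cases p rule: off_diagonal.cases; cases y) (auto simp: diag1_def diag2_def zero_prod_def)
  qed
  then show ?thesis using classify_triangular[OF D' diag sing'] by blast
qed

text \<open>
  If some edge of the cyclic tournament is missing from all digraphs of the space, reversing it makes
  the tournament transitive. Otherwise the space is the one of even weight.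
\<close>

lemma classify_cyclic:
  assumes D: "models D S" "diag1 \<in> D" "diag2 \<in> D" and sing: "\<forall>m\<in>D. singular m"
    and w: "\<forall>p\<in>digraphs D. \<exists>x. p = orient w x" and cyc: "w = (1, 0, 1) \<or> w = (0, 1, 0)"
  shows "\<exists>ns\<in>set all_columns. models (set (span_list ns)) S"
proof -
  let ?M = "{x. orient w x \<in> digraphs D}"
  have M: "digraphs D = orient w ` ?M"
  proof (intro subset_antisym subsetI)
    fix p assume p: "p \<in> digraphs D"
    then obtain x where "p = orient w x" using w by blast
    then show "p \<in> orient w ` ?M" using p by (intro image_eqI[of _ _ x]) simp_all
  qed (elim imageE, simp only: mem_Collect_eq)
  have flip: ?thesis if flip: "\<forall>x\<in>?M. orient w x = orient w' x" and w': "w' \<noteq> (1, 0, 1)" "w' \<noteq> (0, 1, 0)" for w'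
    using classify_oriented[OF D sing _ w'] w flip by (metis mem_Collect_eq)
  have f1: "orient w x = orient (fst w + 1, snd w) x" if "fst x \<noteq> 1" for x
    using that by (cases w; cases x) simp
  have f2: "orient w x = orient (fst w, fst (snd w) + 1, snd (snd w)) x" if "fst (snd x) \<noteq> 1" for x
    using that by (cases w; cases x) simp
  have f3: "orient w x = orient (fst w, fst (snd w), snd (snd w) + 1) x" if "snd (snd x) \<noteq> 1" for x
    using that by (cases w; cases x) simp
  show ?thesis
  proof (cases "(\<exists>x\<in>?M. fst x = 1) \<and> (\<exists>x\<in>?M. fst (snd x) = 1) \<and> (\<exists>x\<in>?M. snd (snd x) = 1)")
    case False
    then consider "\<forall>x\<in>?M. fst x \<noteq> 1" | "\<forall>x\<in>?M. fst (snd x) \<noteq> 1" | "\<forall>x\<in>?M. snd (snd x) \<noteq> 1" by blast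
    then show ?thesis
    proof cases
      case 1
      show ?thesis
      proof (rule flip)
        show "\<forall>x\<in>?M. orient w x = orient (fst w + 1, snd w) x" using 1 f1 by blast
      qed (use cyc in \<open>elim disjE; simp\<close>)+
    next
      case 2
      show ?thesis
      proof (rule flip)
        show "\<forall>x\<in>?M. orient w x = orient (fst w, fst (snd w) + 1, snd (snd w)) x" using 2 f2 by blast
      qed (use cyc in \<open>elim disjE; simp\<close>)+
    next
      case 3
      show ?thesis
      proof (rule flip)
        show "\<forall>x\<in>?M. orient w x = orient (fst w, fst (snd w), snd (snd w) + 1) x" using 3 f3 by blast
      qed (use cyc in \<open>elim disjE; simp\<close>)+
    qed
  next
    case True
    have "(1, 1, 1) \<notin> ?M"
    proof
      assume "(1, 1, 1) \<in> ?M"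
      then have "acyclic_or_full (orient w (1, 1, 1))" using diagonal_decomposition(1)[OF D sing] by blast
      then show False using cyc by auto
    qed
    moreover obtain bs where bs: "bs \<in> set (map fst triangular_reductions)" "set (span_list bs) = ?M"
      using subspace_of_bits[OF digraphs_orient_additive[OF D(1), where w = w]] by blast
    ultimately have "?M = set (span_list [(1, 1, 0), (1, 0, 1)])"
      using even_weight_unique True by blast
    then have "digraphs D = set (span_list (map (orient w) [(1, 1, 0), (1, 0, 1)]))"
      unfolding set_span_list_map[OF additive_orient] using M by argo
    moreover have "map (orient w) [(1, 1, 0), (1, 0, 1)] \<in> set (map fst cyclic_reductions)"
      by (rule bspec[OF cyclic_cases(3)]) (use cyc in \<open>elim disjE; simp\<close>)
    ultimately show ?thesis using reduced_cases[OF D sing] by blast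
  qed
qed

text \<open>
  The members other than zero and the all-ones digraph are transitive tournaments. On each pair of
  vertices the sum of two tournaments has both edges or none, so it is never a tournament; it lies
  in the space only if it is zero or the all-ones digraph, that is, if the two are equal or opposite.
\<close>

lemma classify_full:
  assumes D: "models D S" "diag1 \<in> D" "diag2 \<in> D" and sing: "\<forall>m\<in>D. singular m"
    and full: "full \<in> digraphs D"
  shows "\<exists>ns\<in>set all_columns. models (set (span_list ns)) S"
proof -
  note add = digraphs_additive[OF D(1)]
  have dbl: "p + p = 0" for p :: "bits \<times> bits"
    by (rule double_zero) (intro vector_space_prod vector_space_bit)
  have N: "p \<in> set ([0, full] @ tournaments)" if "p \<in> digraphs D" for p
  proof -
    have "acyclic_or_full p" "acyclic_or_full (p + full)"
      using diagonal_decomposition(1)[OF D sing] that add(2) full by blast+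
    then show ?thesis using complementary_digraphs unfolding set_all_bits by (metis UNIV_I prod.collapse)
  qed
  show ?thesis
  proof (cases "digraphs D \<subseteq> {0, full}")
    case True
    then have "digraphs D = set (span_list [full])" using add(1) full by (auto simp del: split_paired_All)
    then show ?thesis using reduced_cases[OF D sing] cyclic_cases(1) by blast
  next
    case False
    then obtain p where p: "p \<in> digraphs D" "p \<in> set tournaments" using N by fastforce
    have "q \<in> {0, full, p, p + full}" if q: "q \<in> digraphs D" for q
    proof -
      consider "q = 0 \<or> q = full" | "q \<in> set tournaments" using N[OF q] by fastforce
      then show ?thesis
      proof cases
        case 2
        have "p + q \<in> set ([0, full] @ tournaments)" using N add(2) p(1) q by blast
        then show ?thesis using complementary_pairs p(2) 2 by blast
      qed blast
    qed
    then have "digraphs D = {0, full, p, p + full}" using add p(1) full by blast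
    also have "\<dots> = set (span_list [full, p])" by (auto simp: add.commute)
    finally show ?thesis using reduced_cases[OF D sing] cyclic_cases(2) p(2) by blast
  qed
qed

text \<open>
  Without the all-ones digraph, no two members \<open>p\<close> and \<open>q\<close> can use the two directions of the same
  edge, because \<open>p + q\<close> would contain both of them. Hence all members lie in one tournament.
\<close>

lemma classify_diagonal:
  assumes D: "models D S" "diag1 \<in> D" "diag2 \<in> D" and sing: "\<forall>m\<in>D. singular m"
  shows "\<exists>ns\<in>set all_columns. models (set (span_list ns)) S"
proof (cases "full \<in> digraphs D")
  case True then show ?thesis by (rule classify_full[OF D sing])
next
  case False
  let ?N = "digraphs D"
  have good: "acyclic_or_full p" "p \<noteq> full" if "p \<in> ?N" for p
    using diagonal_decomposition(1)[OF D sing] that False by blast+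
  have no_edge_pair: "fst (snd p) * fst (fst p) = 0" "fst (snd (snd p)) * fst (snd (fst p)) = 0"
    "snd (snd (snd p)) * snd (snd (fst p)) = 0" if "p \<in> ?N" for p
    using no_antiparallel_edges[unfolded set_all_bits] good[OF that] by (metis UNIV_I prod.collapse)+
  have one_way: "(\<forall>p\<in>?N. g p = 0) \<or> (\<forall>p\<in>?N. h p = 0)"
    if gh: "additive g" "additive h" "\<And>p. p \<in> ?N \<Longrightarrow> g p * h p = (0 :: bit)" for g h :: "bits \<times> bits \<Rightarrow> bit"
  proof (rule ccontr)
    assume "\<not> ?thesis"
    then obtain p q where pq: "p \<in> ?N" "q \<in> ?N" "g p = 1" "h q = 1" by auto
    then have "h p = 0" "g q = 0" using gh(3)[of p] gh(3)[of q] by auto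
    moreover have "g (p + q) * h (p + q) = 0"
      using gh(3) pq(1,2) digraphs_additive(2)[OF D(1)] by blast
    ultimately show False using pq(3,4) by (simp add: additive.add[OF gh(1)] additive.add[OF gh(2)])
  qed
  have o1: "(\<forall>p\<in>?N. fst (snd p) = 0) \<or> (\<forall>p\<in>?N. fst (fst p) = 0)"
    by (rule one_way[OF _ _ no_edge_pair(1)]) (simp_all only: additive_def fst_add snd_add simp_thms)
  have o2: "(\<forall>p\<in>?N. fst (snd (snd p)) = 0) \<or> (\<forall>p\<in>?N. fst (snd (fst p)) = 0)"
    by (rule one_way[OF _ _ no_edge_pair(2)]) (simp_all only: additive_def fst_add snd_add simp_thms)
  have o3: "(\<forall>p\<in>?N. snd (snd (snd p)) = 0) \<or> (\<forall>p\<in>?N. snd (snd (fst p)) = 0)"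
    by (rule one_way[OF _ _ no_edge_pair(3)]) (simp_all only: additive_def fst_add snd_add simp_thms)
  \<comment> \<open>If a pair of vertices carries no edge at all, either direction will do; the upward one is chosen.\<close>
  define w1 w2 w3 :: bit where "w1 = of_bool (\<forall>p\<in>?N. fst (snd p) = 0)"
    and "w2 = of_bool (\<forall>p\<in>?N. fst (snd (snd p)) = 0)" and "w3 = of_bool (\<forall>p\<in>?N. snd (snd (snd p)) = 0)"
  have split: "g = of_bool A * (g + h) \<and> h = (1 + of_bool A) * (g + h)"
    if "A \<longrightarrow> h = 0" "\<not> A \<longrightarrow> g = 0" for A and g h :: bit
    using that by (cases A) simp_all
  have "\<exists>x. p = orient (w1, w2, w3) x" if p: "p \<in> ?N" for p
  proof -
    obtain a b c x y z where p_eq: "p = ((a, b, c), (x, y, z))" by (metis prod_cases3 prod.exhaust)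
    have "a = w1 * (a + x) \<and> x = (1 + w1) * (a + x)" unfolding w1_def
      by (rule split) (use o1 p p_eq in fastforce)+
    moreover have "b = w2 * (b + y) \<and> y = (1 + w2) * (b + y)" unfolding w2_def
      by (rule split) (use o2 p p_eq in fastforce)+
    moreover have "c = w3 * (c + z) \<and> z = (1 + w3) * (c + z)" unfolding w3_def
      by (rule split) (use o3 p p_eq in fastforce)+
    ultimately have "p = orient (w1, w2, w3) ((a, b, c) + (x, y, z))"
      unfolding p_eq add_Pair orient.simps by (simp only: prod.inject)
    then show ?thesis ..
  qed
  then show ?thesis
    using classify_oriented[OF D sing] classify_cyclic[OF D sing] by blast
qed

section \<open>Coordinates and kernels\<close>

lemma operator_space_frame:
  assumes U: "vector_space (bscale :: bit \<Rightarrow> 'u::ab_group_add \<Rightarrow> 'u)"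
    and V: "vector_space (bscale :: bit \<Rightarrow> 'v::ab_group_add \<Rightarrow> 'v)"
    and S: "operator_space bscale bscale S" "operator_dim bscale (S :: ('u \<Rightarrow> 'v) set) = 3"
  obtains f where "additive f" "inj f" "range f = S" "\<And>c :: bits. additive (f c)"
proof -
  note VF = vector_space_fun[OF V]
  interpret F: vector_space "bscale :: bit \<Rightarrow> ('u \<Rightarrow> 'v) \<Rightarrow> 'u \<Rightarrow> 'v" by (rule VF)
  have sub: "F.subspace S" and lin: "S \<subseteq> lin_maps bscale bscale"
    using S(1) unfolding operator_space_def op_scale_bscale by blast+
  obtain B where B: "B \<subseteq> S" "F.independent B" "S \<subseteq> F.span B" "card B = 3"
    using F.basis_exists[of S] S(2) unfolding operator_dim_def op_scale_bscale by metis
  then obtain s1 s2 s3 where s: "B = {s1, s2, s3}" "distinct [s1, s2, s3]" by (auto simp: card_3_iff)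
  have ind: "indep3 (s1, s2, s3)"
    using B(2) s unfolding s(1) by (intro indep3_of_independent[OF VF]) auto
  have rng: "range (comb (s1, s2, s3)) = S"
    using independent_frame(3)[OF VF ind] F.span_minimal[OF B(1) sub] B(3) s(1) by blast
  show thesis
  proof
    show "additive (comb (s1, s2, s3))" by (rule additive_comb[OF VF])
    show "inj (comb (s1, s2, s3))" by (rule indep3_inj[OF VF ind])
    show "range (comb (s1, s2, s3)) = S" by (rule rng)
    fix c
    have "comb (s1, s2, s3) c \<in> lin_maps bscale bscale" using rng lin by (metis rangeI subsetD)
    then show "additive (comb (s1, s2, s3) c)" by (simp add: lin_maps_def linear_iff_additive[OF U V])
  qed
qed

text \<open>
  If all values lie in the span of the independent family \<open>v\<close>, then \<open>v\<close> is a basis of \<open>V\<close>, as the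
  values span \<open>V\<close>, and coordinates in it give \<open>\<theta>\<close>.
\<close>

lemma models_frame:
  assumes V: "vector_space (bscale :: bit \<Rightarrow> 'v::ab_group_add \<Rightarrow> 'v)"
    and f: "additive (f :: bits \<Rightarrow> 'u::ab_group_add \<Rightarrow> 'v)" "inj f" "range f = S" "\<And>c. additive (f c)"
    and v: "indep3 v" and inside: "\<And>c u. f c u \<in> range (comb v)" and red: "reduced bscale S"
  obtains \<theta> where "\<And>c u. f c u = comb v (comb (\<theta> u) c)" "models (range \<theta>) S"
proof -
  interpret V: vector_space "bscale :: bit \<Rightarrow> 'v \<Rightarrow> 'v" by (rule V)
  obtain v1 v2 v3 where v_eq: "v = (v1, v2, v3)" by (metis prod_cases3)
  have "(\<Union>s\<in>S. range s) \<subseteq> range (comb v)" using inside f(3) by blast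
  moreover have "V.subspace (range (comb v))"
    using independent_frame(3)[OF V v[unfolded v_eq]] V.subspace_span unfolding v_eq by metis
  ultimately have "V.span (\<Union>s\<in>S. range s) \<subseteq> range (comb v)" by (rule V.span_minimal)
  then have bij: "bij (comb v)"
    using red indep3_inj[OF V v] unfolding reduced_def bij_def by blast
  note aV = additive_comb[OF V, of v]
  define g where "g = inv_into UNIV (comb v)"
  have g: "comb v (g w) = w" for w using bij unfolding g_def by (metis bij_inv_eq_iff)
  have ag: "additive g" unfolding g_def by (rule additive_inv[OF bij aV])
  define \<theta> where "\<theta> u = (g (f (1,0,0) u), g (f (0,1,0) u), g (f (0,0,1) u))" for u
  have eq: "f c u = comb v (comb (\<theta> u) c)" for c u
  proof -
    have "comb v (comb (\<theta> u) c) = comb (f (1,0,0) u, f (0,1,0) u, f (0,0,1) u) c"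
      unfolding \<theta>_def additive_comb_eq[OF aV] g ..
    also have "\<dots> = f c u"
      unfolding comb_apply[symmetric] additive_eq_comb[OF f(1), symmetric] ..
    finally show ?thesis ..
  qed
  have "additive \<theta>"
    unfolding additive_def \<theta>_def by (simp only: add_Pair additive.add[OF f(4)] additive.add[OF ag] simp_thms)
  moreover from this have "inj \<theta>"
  proof (subst additive_inj_iff, assumption, intro allI impI)
    fix u assume "\<theta> u = 0"
    then have "f c u = 0" for c unfolding eq by simp
    then show "u = 0" using red f(3) unfolding reduced_def by blast
  qed
  ultimately have "models (range \<theta>) S"
    unfolding models_def using f(1-3) aV bij eq by blast
  then show thesis using that eq by blast
qed

definition kernel_line :: "(bits \<Rightarrow> 'u \<Rightarrow> 'v::zero) \<Rightarrow> 'u \<Rightarrow> bits \<Rightarrow> bool" where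
  "kernel_line f u k \<longleftrightarrow> k \<noteq> 0 \<and> (\<forall>c. f c u = 0 \<longleftrightarrow> c = 0 \<or> c = k)"

text \<open>
  The plane through \<open>a\<close> and \<open>b\<close> is not LLD, so some \<open>u\<close> is killed by none of its nonzero members. The
  kernel of \<open>u\<close> in \<open>S\<close> meets this plane trivially, hence is a line.
\<close>

lemma minimal_LLD_kernel_line:
  assumes V: "vector_space (bscale :: bit \<Rightarrow> 'v::ab_group_add \<Rightarrow> 'v)"
    and f: "additive (f :: bits \<Rightarrow> 'u \<Rightarrow> 'v)" "inj f" and min: "minimal_LLD bscale (range f)"
    and ab: "a \<noteq> 0" "b \<noteq> 0" "a \<noteq> b"
  obtains u k where "kernel_line f u k" "k \<notin> {0, a, b, a + b}"
proof -
  have f0: "f c = 0 \<longleftrightarrow> c = 0" for c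
    using f(2) additive.zero[OF f(1)] by (metis injD)
  have dbl: "x + x = 0" for x :: bits by (rule double_zero[OF vector_space_bits])
  let ?P = "{0, a, b, a + b}" and ?T = "f ` {0, a, b, a + b}"
  interpret B: vector_space "bscale :: bit \<Rightarrow> bits \<Rightarrow> bits" by (rule vector_space_bits)
  have P_span: "?P = B.span {a, b}"
    using set_span_list[OF vector_space_bits, of "[a, b]"] by (simp add: insert_commute)
  have "s + t \<in> ?T" if st: "s \<in> ?T" "t \<in> ?T" for s t
  proof -
    obtain x y where "x \<in> ?P" "y \<in> ?P" "s = f x" "t = f y" using st by blast
    then show ?thesis
      using B.span_add[of x "{a, b}" y] unfolding P_span by (simp only: additive.add[OF f(1), symmetric] imageI)
  qed
  moreover have "0 \<in> ?T" using additive.zero[OF f(1)] by (metis image_eqI insertI1)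
  ultimately have "module.subspace (op_scale bscale) ?T"
    unfolding op_scale_bscale subspace_bscale_iff[OF vector_space_fun[OF V]] by blast
  moreover have "?T \<subset> range f"
  proof -
    have "card ?P \<le> 4" using card_insert_le_m1 card.empty by (simp add: card_insert_if)
    moreover have "card (UNIV :: bits set) = 8"
      unfolding set_all_bits[symmetric] distinct_card[OF distinct_all_bits] by (simp add: all_bits_def)
    ultimately have "card ?P \<noteq> card (UNIV :: bits set)" by linarith
    then have "?P \<noteq> UNIV" by metis
    then obtain k0 where "k0 \<notin> ?P" by blast
    then have "f k0 \<notin> ?T" using f(2) by (simp only: inj_image_mem_iff not_False_eq_True)
    then show ?thesis by blast
  qed
  ultimately have "\<not> LLD ?T" using min unfolding minimal_LLD_def by blast
  then obtain u where "\<forall>s\<in>?T. s \<noteq> 0 \<longrightarrow> s u \<noteq> 0" unfolding LLD_def by blast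
  then have u: "f c u \<noteq> 0" if "c \<in> ?P" "c \<noteq> 0" for c using that f0 by blast
  obtain k where k: "k \<noteq> 0" "f k u = 0"
    using min f0 unfolding minimal_LLD_def LLD_def by (metis rangeE)
  then have kP: "k \<notin> ?P" using u by blast
  have "c = 0 \<or> c = k" if c: "f c u = 0" for c
  proof (rule ccontr)
    assume "\<not> ?thesis"
    then have ck: "c \<noteq> 0" "c \<noteq> k" by auto
    have "indep3 (a, b, k)" using ab kP by (simp add: indep3_iff[OF vector_space_bits])
    then obtain x y z where xyz: "comb (a, b, k) (x, y, z) = c"
      using indep3_bij by (metis bij_pointE prod_cases3)
    have P: "bscale x a + bscale y b \<in> ?P" by (cases x; cases y) simp_all
    have "f (bscale x a + bscale y b) u = 0"
    proof (cases "z = 0")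
      case True then show ?thesis using xyz c by simp
    next
      case False
      then have "f (bscale x a + bscale y b) u + f k u = f c u"
        using xyz additive.add[OF f(1), of "bscale x a + bscale y b" k] by (simp add: plus_fun_def)
      then show ?thesis using c k by simp
    qed
    then have z: "bscale x a + bscale y b = 0" using u P by blast
    show False using xyz ck unfolding comb.simps z by (cases z) auto
  qed
  moreover have "f 0 u = 0" using additive.zero[OF f(1)] by simp
  ultimately have "kernel_line f u k" using k unfolding kernel_line_def by blast
  then show thesis using that kP by blast
qed

text \<open>
  Each further kernel is found outside the plane that contains the previous ones.
\<close>

lemma minimal_LLD_kernel_frame:
  assumes V: "vector_space (bscale :: bit \<Rightarrow> 'v::ab_group_add \<Rightarrow> 'v)"
    and f: "additive (f :: bits \<Rightarrow> 'u \<Rightarrow> 'v)" "inj f" and min: "minimal_LLD bscale (range f)"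
  obtains k1 k2 k3 u1 u2 u3 where "indep3 (k1, k2, k3)"
    "kernel_line f u1 k1" "kernel_line f u2 k2" "kernel_line f u3 k3"
proof -
  note line = minimal_LLD_kernel_line[OF assms]
  have "(1,0,0) \<noteq> (0 :: bits)" "(0,1,0) \<noteq> (0 :: bits)" "(1,0,0) \<noteq> ((0,1,0) :: bits)"
    by (simp_all add: zero_prod_def)
  from line[OF this] obtain u1 k1 where 1: "kernel_line f u1 k1" by metis
  have "k1 \<noteq> 0" using 1 by (simp add: kernel_line_def)
  obtain a where "a \<noteq> 0" "a \<noteq> k1"
  proof (cases "k1 = (1,0,0)")
    case True then show thesis using that[of "(0,1,0)"] by (simp add: zero_prod_def)
  next
    case False then show thesis using that[of "(1,0,0)"] by (simp add: zero_prod_def)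
  qed
  then obtain u2 k2 where 2: "kernel_line f u2 k2" "k2 \<notin> {0, k1, a, k1 + a}"
    using line[OF \<open>k1 \<noteq> 0\<close>] by metis
  then have "k2 \<noteq> 0" "k1 \<noteq> k2" by auto
  then obtain u3 k3 where 3: "kernel_line f u3 k3" "k3 \<notin> {0, k1, k2, k1 + k2}"
    using line[OF \<open>k1 \<noteq> 0\<close>] by metis
  have "indep3 (k1, k2, k3)" using \<open>k1 \<noteq> 0\<close> \<open>k1 \<noteq> k2\<close> 2(2) 3(2) by (simp add: indep3_iff[OF vector_space_bits])
  then show thesis using that 1 2(1) 3(1) by blast
qed

section \<open>A kernel outside an image\<close>

definition diagonal_pair :: "(bits \<Rightarrow> 'u \<Rightarrow> 'v::zero) \<Rightarrow> 'v \<times> 'v \<times> 'v \<Rightarrow> 'u \<Rightarrow> 'u \<Rightarrow> bool" where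
  "diagonal_pair f v u1 u2 \<longleftrightarrow>
     f (1,0,0) u1 = fst v \<and> f (0,1,0) u1 = fst (snd v) \<and> f (0,0,1) u1 = 0 \<and>
     f (1,0,0) u2 = 0 \<and> f (0,1,0) u2 = fst (snd v) \<and> f (0,0,1) u2 = snd (snd v)"

text \<open>
  Take an operator \<open>k'\<close> that kills \<open>u'\<close> and an operator \<open>l\<close> that kills \<open>u + u'\<close>. Then \<open>l\<close> takes the same
  value at \<open>u\<close> and \<open>u'\<close>, and in the basis \<open>k\<close>, \<open>l\<close>, \<open>k'\<close> the vectors \<open>u'\<close> and \<open>u\<close> have the
  values \<open>(k u', l u, 0)\<close> and \<open>(0, l u, k' u)\<close>. The operators and the values are independent
  because only \<open>k\<close> kills \<open>u\<close> and because \<open>k u'\<close> lies outside the image of \<open>u\<close>.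
\<close>

lemma exists_diagonal_pair:
  assumes V: "vector_space (bscale :: bit \<Rightarrow> 'v::ab_group_add \<Rightarrow> 'v)"
    and f: "additive (f :: bits \<Rightarrow> 'u::ab_group_add \<Rightarrow> 'v)" "inj f" "\<And>c. additive (f c)"
    and lld: "\<And>u. \<exists>c. c \<noteq> 0 \<and> f c u = 0"
    and line: "kernel_line f u k" and out: "f k u' \<notin> range (\<lambda>c. f c u)"
  obtains K v where "indep3 K" "indep3 v" "diagonal_pair (\<lambda>c. f (comb K c)) v u' u"
proof -
  have fadd: "f (c + d) w = f c w + f d w" for c d w by (simp add: additive.add[OF f(1)] plus_fun_def)
  have f0: "f 0 w = 0" for w by (simp add: additive.zero[OF f(1)])
  have eq: "x + y = 0 \<longleftrightarrow> x = y" for x y :: 'v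
    by (metis double_zero[OF V] add_left_cancel)
  have k: "k \<noteq> 0" "\<And>c. f c u = 0 \<longleftrightarrow> c = 0 \<or> c = k" using line unfolding kernel_line_def by blast+
  obtain k' where k': "k' \<noteq> 0" "f k' u' = 0" using lld by blast
  obtain l where l: "l \<noteq> 0" "f l (u + u') = 0" using lld by blast
  have fl: "f l u = f l u'" using l(2) additive.add[OF f(3)] eq by metis
  have "f k u' \<noteq> 0" using out f0 by (metis rangeI)
  then have "k' \<noteq> k" using k'(2) by blast
  have "l \<noteq> k" using fl k \<open>f k u' \<noteq> 0\<close> by metis
  have "l \<noteq> k'" using fl k' k(2) l(1) \<open>l \<noteq> k\<close> by metis
  have "l \<noteq> k + k'"
  proof
    assume "l = k + k'"
    moreover have "f k u = 0" using k(2) by blast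
    ultimately have "f k' u = f k u'" using fl fadd[of k k' u] fadd[of k k' u'] k'(2) by simp
    then show False using out by (metis rangeI)
  qed
  then have "l \<noteq> k' + k" by (simp add: add.commute)
  have swap: "y = x + z" if "x + y = z" for x y z :: bits
    by (simp add: that[symmetric] add.assoc[symmetric] double_zero[OF vector_space_bits] del: add_Pair)
  have "k' \<noteq> k + l" using swap[of k l k'] \<open>l \<noteq> k + k'\<close> by metis
  then have K: "indep3 (k, l, k')"
    using k(1) k'(1) l(1) \<open>k' \<noteq> k\<close> \<open>l \<noteq> k\<close> \<open>l \<noteq> k'\<close>
    by (simp add: indep3_iff[OF vector_space_bits])
  have "indep3 (f k u', f l u, f k' u)"
    unfolding indep3_def
  proof (intro allI impI)
    fix x assume x: "comb (f k u', f l u, f k' u) x = 0"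
    obtain x1 x2 x3 where x_eq: "x = (x1, x2, x3)" by (metis prod_cases3)
    have ex: "f (bscale x2 l + bscale x3 k') u = bscale x2 (f l u) + bscale x3 (f k' u)"
      by (cases x2; cases x3) (simp_all add: fadd f0)
    have x1: "x1 = 0"
    proof (rule ccontr)
      assume "x1 \<noteq> 0"
      then have "f k u' = f (bscale x2 l + bscale x3 k') u" using x eq unfolding x_eq ex by (simp add: add.assoc)
      then show False using out by (metis rangeI)
    qed
    then have "f (bscale x2 l + bscale x3 k') u = 0" using x unfolding ex x_eq by simp
    then have "bscale x2 l + bscale x3 k' = 0 \<or> bscale x2 l + bscale x3 k' = k" using k(2) by blast
    moreover have "l + k' \<noteq> k" using swap[of l k' k] \<open>k' \<noteq> k + l\<close> by (auto simp only: add.commute)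
    moreover have "l + k' \<noteq> 0" using swap[of l k' 0] \<open>l \<noteq> k'\<close> by (auto simp only: add_0_right)
    ultimately have "x2 = 0 \<and> x3 = 0" using \<open>l \<noteq> k\<close> \<open>k' \<noteq> k\<close> l(1) k'(1)
      by (cases "x2 = 0"; cases "x3 = 0")
        (simp_all only: bit_not_zero_iff bscale_simps add_0_left add_0_right simp_thms)
    then show "x = 0" using x1 unfolding x_eq by (simp add: zero_prod_def)
  qed
  moreover have "diagonal_pair (\<lambda>c. f (comb (k, l, k') c)) (f k u', f l u, f k' u) u' u"
    unfolding diagonal_pair_def using k k'(2) fl by simp
  ultimately show thesis using that K by blast
qed

text \<open>
  A value outside the span of \<open>v\<close> would give a fourth row for the matrix of \<open>u\<close>, on which the diagonal
  shifts have no effect. The three minors that contain this row have to vanish for all shifts, and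
  this makes the row zero.
\<close>

lemma diagonal_pair_inside:
  assumes V: "vector_space (bscale :: bit \<Rightarrow> 'v::ab_group_add \<Rightarrow> 'v)"
    and f: "additive (f :: bits \<Rightarrow> 'u::ab_group_add \<Rightarrow> 'v)" "\<And>c. additive (f c)"
    and lld: "\<And>u. \<exists>c. c \<noteq> 0 \<and> f c u = 0"
    and v: "indep3 v" and pair: "diagonal_pair f v u1 u2"
  shows "f c u \<in> range (comb v)"
proof (rule ccontr)
  assume out: "f c u \<notin> range (comb v)"
  interpret V: vector_space "bscale :: bit \<Rightarrow> 'v \<Rightarrow> 'v" by (rule V)
  have VW: "vector_space (bscale :: bit \<Rightarrow> bits \<times> bit \<Rightarrow> bits \<times> bit)"
    by (intro vector_space_prod vector_space_bit)
  interpret W: vector_space "bscale :: bit \<Rightarrow> bits \<times> bit \<Rightarrow> bits \<times> bit" by (rule VW)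
  interpret VW: vector_space_pair "bscale :: bit \<Rightarrow> 'v \<Rightarrow> 'v" "bscale :: bit \<Rightarrow> bits \<times> bit \<Rightarrow> bits \<times> bit" ..
  obtain v1 v2 v3 where v_eq: "v = (v1, v2, v3)" by (metis prod_cases3)
  note fr = independent_frame[OF V v[unfolded v_eq]]
  have w: "f c u \<notin> V.span {v1, v2, v3}" using out fr(3) v_eq by simp
  then have w': "f c u \<noteq> v1" "f c u \<noteq> v2" "f c u \<noteq> v3" by (auto intro: V.span_base)
  have "V.independent (insert (f c u) {v1, v2, v3})" by (rule V.independent_insertI[OF w fr(2)])
  \<comment> \<open>The functional that produces the additional row is the second component of \<open>g\<close>.\<close>
  from VW.linear_independent_extend[OF this, of "\<lambda>x. if x = v1 then ((1,0,0), 0)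
      else if x = v2 then ((0,1,0), 0) else if x = v3 then ((0,0,1), 0) else ((0,0,0), 1)"]
  obtain g :: "'v \<Rightarrow> bits \<times> bit" where g: "Vector_Spaces.linear bscale bscale g"
    "\<forall>x\<in>insert (f c u) {v1, v2, v3}. g x = (if x = v1 then ((1,0,0), 0) else if x = v2 then ((0,1,0), 0)
       else if x = v3 then ((0,0,1), 0) else ((0,0,0), 1))"
    by (elim exE conjE)
  have ag: "additive g" using g(1) by (simp only: linear_iff_additive[OF V VW])
  have ne: "v1 \<noteq> v2" "v2 \<noteq> v1" "v3 \<noteq> v1" "v3 \<noteq> v2" using fr(1) by auto
  have gv: "g v1 = ((1,0,0), 0)" "g v2 = ((0,1,0), 0)" "g v3 = ((0,0,1), 0)" "g (f c u) = ((0,0,0), 1)"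
    using g(2) w' ne by simp_all
  let ?e1 = "(1,0,0) :: bits" and ?e2 = "(0,1,0) :: bits" and ?e3 = "(0,0,1) :: bits"
  define G where "G e = g (f e u)" for e
  have zero: "\<exists>x. x \<noteq> 0 \<and> comb (G ?e1 + ((p, 0, 0), 0), G ?e2 + ((0, p + q, 0), 0), G ?e3 + ((0, 0, q), 0)) x = 0"
    for p q
  proof -
    let ?u = "u + (bscale p u1 + bscale q u2)"
    obtain x where x: "x \<noteq> 0" "f x ?u = 0" using lld by blast
    have fe: "g (f e ?u) = G e + (bscale p (g (f e u1)) + bscale q (g (f e u2)))" for e
      unfolding G_def by (cases "p = 0"; cases "q = 0")
        (simp_all only: bit_not_zero_iff bscale_simps additive.add[OF ag] additive.add[OF f(2)] add_0_left add_0_right)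
    have "0 = g (f x ?u)" by (simp only: x(2) additive.zero[OF ag])
    also have "\<dots> = comb (g (f ?e1 ?u), g (f ?e2 ?u), g (f ?e3 ?u)) x"
      unfolding additive_comb_eq[OF ag, symmetric] comb_apply[symmetric] additive_eq_comb[OF f(1), symmetric] ..
    finally have 0: "comb (g (f ?e1 ?u), g (f ?e2 ?u), g (f ?e3 ?u)) x = 0" ..
    have "bscale p ((1,0,0), 0) + bscale q 0 = (((p,0,0), 0) :: bits \<times> bit)"
      "bscale p ((0,1,0), 0) + bscale q ((0,1,0), 0) = (((0,p + q,0), 0) :: bits \<times> bit)"
      "bscale p 0 + bscale q ((0,0,1), 0) = (((0,0,q), 0) :: bits \<times> bit)"
      by (cases p; cases q; simp add: zero_prod_def)+
    then have "g (f ?e1 ?u) = G ?e1 + ((p, 0, 0), 0)" "g (f ?e2 ?u) = G ?e2 + ((0, p + q, 0), 0)"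
      "g (f ?e3 ?u) = G ?e3 + ((0, 0, q), 0)"
      using pair unfolding fe diagonal_pair_def v_eq by (simp_all only: fst_conv snd_conv gv additive.zero[OF ag])
    then show ?thesis using x(1) 0 by metis
  qed
  have minor: "singular (\<mu> (G ?e1 + ((p, 0, 0), 0)), \<mu> (G ?e2 + ((0, p + q, 0), 0)), \<mu> (G ?e3 + ((0, 0, q), 0)))"
    if "additive \<mu>" for \<mu> p q
    using zero[of p q] additive_comb_eq[OF that] additive.zero[OF that] unfolding singular_def set_all_bits
    by (metis UNIV_I)
  \<comment> \<open>The maps replace the first, second or third row by the additional row.\<close>
  define \<mu>1 \<mu>2 \<mu>3 :: "bits \<times> bit \<Rightarrow> bits" where "\<mu>1 w = (snd w, snd (fst w))"
    and "\<mu>2 w = (fst (fst w), snd w, snd (snd (fst w)))" and "\<mu>3 w = (fst (fst w), fst (snd (fst w)), snd w)" for w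
  note \<mu> = \<mu>1_def \<mu>2_def \<mu>3_def
  have a\<mu>: "additive \<mu>1" "additive \<mu>2" "additive \<mu>3"
    by (simp_all only: additive_def \<mu> fst_add snd_add add_Pair simp_thms)
  have pq: "(p + q) + q = p" "p + (p + q) = q" for p q :: bit by (cases p; cases q; simp)+
  have "singular (\<mu>1 (G ?e1), \<mu>1 (G ?e2) + (0, p, 0), \<mu>1 (G ?e3) + (0, 0, q))" for p q
    using minor[OF a\<mu>(1), of "p + q" q] unfolding pq additive.add[OF a\<mu>(1)]
    by (simp add: \<mu> flip: zero_prod_def)
  then have r1: "snd (G ?e1) = 0" using singular_minor1 unfolding set_all_bits by (metis UNIV_I \<mu>1_def fst_conv)
  have "singular (\<mu>2 (G ?e1) + (p, 0, 0), \<mu>2 (G ?e2), \<mu>2 (G ?e3) + (0, 0, q))" for p q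
    using minor[OF a\<mu>(2), of p q] unfolding additive.add[OF a\<mu>(2)]
    by (simp add: \<mu> flip: zero_prod_def)
  then have r2: "snd (G ?e2) = 0" using singular_minor2 unfolding set_all_bits by (metis UNIV_I \<mu>2_def fst_conv snd_conv)
  have "singular (\<mu>3 (G ?e1) + (p, 0, 0), \<mu>3 (G ?e2) + (0, q, 0), \<mu>3 (G ?e3))" for p q
    using minor[OF a\<mu>(3), of p "p + q"] unfolding pq additive.add[OF a\<mu>(3)]
    by (simp add: \<mu> flip: zero_prod_def)
  then have r3: "snd (G ?e3) = 0" using singular_minor3 unfolding set_all_bits by (metis UNIV_I \<mu>3_def snd_conv)
  have asnd: "additive (snd :: bits \<times> bit \<Rightarrow> bit)" by (simp only: additive_def snd_add simp_thms)
  have "g (f c u) = comb (G ?e1, G ?e2, G ?e3) c"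
    unfolding G_def additive_comb_eq[OF ag, symmetric] comb_apply[symmetric] additive_eq_comb[OF f(1), symmetric] ..
  then have "snd (g (f c u)) = comb (0, 0, 0) c" by (simp only: additive_comb_eq[OF asnd] r1 r2 r3)
  then have "snd (g (f c u)) = 0" by (simp only: zero_prod_def[symmetric] comb_zero_left)
  then show False using gv(4) by simp
qed

lemma frame_change:
  assumes f: "additive f" "inj f" "range f = S" and K: "indep3 (K :: mat3)"
  shows "additive (\<lambda>c. f (comb K c))" "inj (\<lambda>c. f (comb K c))" "range (\<lambda>c. f (comb K c)) = S"
proof -
  have bK: "bij (comb K)" by (rule indep3_bij[OF K])
  show "additive (\<lambda>c. f (comb K c))"
    by (rule additive_comp[OF f(1) additive_comb[OF vector_space_bits]])
  show "inj (\<lambda>c. f (comb K c))" using inj_compose[OF f(2), of "comb K"] bK by (simp add: comp_def bij_def)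
  show "range (\<lambda>c. f (comb K c)) = S" using f(3) bK image_image[of f "comb K" UNIV] by (simp add: bij_def)
qed

lemma coordinates_eqI:
  assumes "inj (comb v)" and f: "\<And>c. f c = comb v (comb m c)"
    and "f (1,0,0) = comb v a" "f (0,1,0) = comb v b" "f (0,0,1) = comb v c"
  shows "m = (a, b, c)"
proof -
  obtain a' b' c' where m: "m = (a', b', c')" by (metis prod_cases3)
  have "comb v a' = comb v a" "comb v b' = comb v b" "comb v c' = comb v c"
    using assms(3-) unfolding f m by simp_all
  then show ?thesis using assms(1) m by (metis injD)
qed

text \<open>
  The diagonal pair provides coordinates in which both diagonal matrices belong to \<open>D\<close>.
\<close>

lemma classify_escaping:
  assumes V: "vector_space (bscale :: bit \<Rightarrow> 'v::ab_group_add \<Rightarrow> 'v)"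
    and f: "additive (f :: bits \<Rightarrow> 'u::ab_group_add \<Rightarrow> 'v)" "inj f" "range f = S" "\<And>c. additive (f c)"
    and red: "reduced bscale S" and lld: "LLD S"
    and line: "kernel_line f u k" and out: "f k u' \<notin> range (\<lambda>c. f c u)"
  shows "\<exists>ns\<in>set all_columns. models (set (span_list ns)) S"
proof -
  have lldf: "\<exists>c. c \<noteq> 0 \<and> f c w = 0" for w
  proof -
    obtain s where s: "s \<in> range f" "s \<noteq> 0" "s w = 0" using lld unfolding f(3) LLD_def by blast
    then obtain c where "s = f c" by blast
    then show ?thesis using s(2,3) additive.zero[OF f(1)] by metis
  qed
  obtain K v where K: "indep3 K" and v: "indep3 v" and pair: "diagonal_pair (\<lambda>c. f (comb K c)) v u' u"
    by (rule exists_diagonal_pair[OF V f(1,2,4) lldf line out])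
  let ?f = "\<lambda>c. f (comb K c)"
  have bK: "bij (comb K)" by (rule indep3_bij[OF K])
  note F = frame_change[OF f(1-3) K]
  have lldF: "\<exists>c. c \<noteq> 0 \<and> ?f c w = 0" for w
  proof -
    obtain c where "c \<noteq> 0" "f c w = 0" using lldf by blast
    moreover obtain c' where "c = comb K c'" using bK by (metis bij_pointE)
    ultimately show ?thesis by (metis comb_zero_right)
  qed
  have inside: "?f c w \<in> range (comb v)" for c w
    by (rule diagonal_pair_inside[OF V F(1) f(4) lldF v pair])
  obtain \<theta> where \<theta>: "\<And>c w. ?f c w = comb v (comb (\<theta> w) c)" "models (range \<theta>) S"
    using models_frame[OF V F f(4) v inside red] by blast
  have inj_v: "inj (comb v)" by (rule indep3_inj[OF V v])
  obtain v1 v2 v3 where v_eq: "v = (v1, v2, v3)" by (metis prod_cases3)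
  have vu: "comb v (1,0,0) = v1" "comb v (0,1,0) = v2" "comb v (0,0,1) = v3" "comb v (0,0,0) = 0"
    unfolding v_eq by simp_all
  have pair': "?f (1,0,0) u' = v1" "?f (0,1,0) u' = v2" "?f (0,0,1) u' = 0"
    "?f (1,0,0) u = 0" "?f (0,1,0) u = v2" "?f (0,0,1) u = v3"
    using pair unfolding diagonal_pair_def v_eq by (simp_all only: fst_conv snd_conv)
  have "\<theta> u' = diag1" unfolding diag1_def by (rule coordinates_eqI[OF inj_v \<theta>(1)]) (simp_all only: pair' vu)
  moreover have "\<theta> u = diag2" unfolding diag2_def by (rule coordinates_eqI[OF inj_v \<theta>(1)]) (simp_all only: pair' vu)
  ultimately have "diag1 \<in> range \<theta>" "diag2 \<in> range \<theta>" by (metis rangeI)+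
  moreover have "\<forall>m\<in>range \<theta>. singular m"
  proof
    fix m assume "m \<in> range \<theta>"
    then obtain w where m: "m = \<theta> w" by blast
    obtain c where c: "c \<noteq> 0" "?f c w = 0" using lldF by blast
    then have "comb (\<theta> w) c = 0" unfolding \<theta>(1) using v unfolding indep3_def by blast
    then show "singular m" using c(1) unfolding m singular_def set_all_bits by blast
  qed
  ultimately show ?thesis by (rule classify_diagonal[OF \<theta>(2)])
qed

section \<open>Kernels inside the images\<close>

lemma plane_eq:
  fixes a b x y :: "'v::ab_group_add"
  assumes dbl: "\<And>v :: 'v. v + v = 0"
    and "x \<in> {0, a, b, a + b}" "y \<in> {0, a, b, a + b}" "x \<noteq> 0" "y \<noteq> 0" "x \<noteq> y"
  shows "{0, x, y, x + y} = {0, a, b, a + b}"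
proof -
  have "a + (a + b) = b" "b + (a + b) = a" "a + b + a = b" "a + b + b = a"
    using dbl by (metis add.assoc add.commute add_0)+
  then show ?thesis using assms(2-) by (elim insertE emptyE) (auto simp: add.commute)
qed

text \<open>
  The three planes are the images of three vectors whose kernels form a basis. Two distinct planes
  share at most one nonzero vector, so two different common vectors force equality of planes.
\<close>

lemma three_planes:
  fixes a b c d e g :: "'v::ab_group_add"
  assumes dbl: "\<And>v :: 'v. v + v = 0"
    and nz: "a \<noteq> 0" "b \<noteq> 0" "a \<noteq> b" "c \<noteq> 0" "d \<noteq> 0" "c \<noteq> d" "e \<noteq> 0" "g \<noteq> 0" "e \<noteq> g"
    and 1: "c \<in> {0, a, b, a + b}" "e \<in> {0, a, b, a + b}"
    and 2: "a \<in> {0, c, d, c + d}" "g \<in> {0, c, d, c + d}"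
    and 3: "b \<in> {0, e, g, e + g}" "d \<in> {0, e, g, e + g}"
  shows "({0, c, d, c + d} = {0, a, b, a + b} \<and> {0, e, g, e + g} = {0, a, b, a + b}) \<or>
    (c = a \<and> e = b \<and> g = d \<and> d \<noteq> a + b)"
proof -
  let ?W1 = "{0, a, b, a + b}" and ?W2 = "{0, c, d, c + d}" and ?W3 = "{0, e, g, e + g}"
  note pl = plane_eq[OF dbl]
  have self: "x \<in> {0, x, y, x + y}" "y \<in> {0, x, y, x + y}" for x y :: 'v by simp_all
  show ?thesis
  proof (cases "c = a")
    case False
    have "{0, a, c, a + c} = ?W1" using pl[of a a b c] self 1 nz False by blast
    moreover have "{0, a, c, a + c} = ?W2" using pl[of a c d c] self 2 nz False by blast
    ultimately have W: "?W2 = ?W1" by simp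
    then have "?W3 = ?W1" using pl[of e a b g] 1(2) 2(2) nz by blast
    then show ?thesis using W by blast
  next
    case ca: True
    show ?thesis
    proof (cases "e = b")
      case False
      have "{0, b, e, b + e} = ?W1" using pl[of b a b e] self 1 nz False by blast
      moreover have "{0, b, e, b + e} = ?W3" using pl[of b e g e] self 3 nz False by blast
      ultimately have W: "?W3 = ?W1" by simp
      then have "?W2 = ?W1" using pl[of c a b d] 1(1) 3(2) nz by blast
      then show ?thesis using W by blast
    next
      case eb: True
      show ?thesis
      proof (cases "g = d")
        case False
        have "{0, d, g, d + g} = ?W2" using pl[of d c d g] self 2 nz False by blast
        moreover have "{0, d, g, d + g} = ?W3" using pl[of d e g g] self 3 nz False by blast
        ultimately have W: "?W3 = ?W2" by simp
        then have "?W1 = ?W2" using pl[of a c d b] 2(1) 3(1) nz by blast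
        then show ?thesis using W by blast
      next
        case gd: True
        show ?thesis
        proof (cases "d = a + b")
          case True
          then have "?W2 = ?W1" using pl[of c a b d] 1(1) nz by simp
          moreover have "?W3 = ?W1" using pl[of e a b g] 1(2) nz True gd by simp
          ultimately show ?thesis by blast
        qed (use ca eb gd in blast)
      qed
    qed
  qed
qed

lemma dim_plane:
  assumes V: "vector_space (bscale :: bit \<Rightarrow> 'v::ab_group_add \<Rightarrow> 'v)"
    and S: "range f = S" and red: "reduced bscale S"
    and ab: "a \<noteq> 0" "b \<noteq> 0" "a \<noteq> b" and inside: "\<And>c u. f c u \<in> {0, a, b, a + b :: 'v}"
  shows "vector_space.dim bscale (UNIV :: 'v set) = 2"
proof -
  interpret V: vector_space "bscale :: bit \<Rightarrow> 'v \<Rightarrow> 'v" by (rule V)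
  have span: "V.span {a, b} = {0, a, b, a + b}"
    using set_span_list[OF V, of "[a, b]"] by (simp add: insert_commute)
  have "(\<Union>s\<in>S. range s) \<subseteq> V.span {a, b}" unfolding span S[symmetric] using inside by blast
  then have "V.span (\<Union>s\<in>S. range s) \<subseteq> V.span {a, b}"
    using V.span_minimal V.subspace_span by blast
  then have "V.span {a, b} = V.span UNIV" using red unfolding reduced_def by auto
  moreover have "V.independent {b, a}"
  proof (rule V.independent_insertI)
    show "V.independent {a}" using ab(1) by (simp add: V.dependent_single)
    show "b \<notin> V.span {a}" using ab set_span_list[OF V, of "[a]"] by auto
  qed
  ultimately show ?thesis using V.dim_eq_card[of "{a, b}" UNIV] ab(3) by (simp add: insert_commute)
qed

text \<open>
  No matrix outside the alternating space maps the kernel of each nonzero alternating matrix into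
  the image of that matrix.
\<close>

lemma alternating_maximal:
  "\<forall>a\<in>set all_bits. \<forall>b\<in>set all_bits. \<forall>c\<in>set all_bits.
     (\<forall>m\<in>set (span_list (columns_c ! 0)). \<forall>k\<in>set all_bits.
        k \<noteq> 0 \<longrightarrow> m \<noteq> 0 \<longrightarrow> comb m k = 0 \<longrightarrow> comb (a, b, c) k \<in> set (map (comb m) all_bits)) \<longrightarrow>
     (a, b, c) \<in> set (span_list (columns_c ! 0))"
  by code_simp

lemma alternating_lines:
  "\<forall>m\<in>set (span_list (columns_c ! 0)). \<forall>k\<in>set all_bits. \<forall>c\<in>set all_bits.
     k \<noteq> 0 \<longrightarrow> m \<noteq> 0 \<longrightarrow> comb m k = 0 \<longrightarrow> comb m c = 0 \<longrightarrow> c = 0 \<or> c = k"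
  by code_simp

lemma range_comb_zero:
  "range (comb (0, a, b)) = {0, a, b, a + b}" "range (comb (a, 0, b)) = {0, a, b, a + b}"
  "range (comb (a, b, 0)) = {0, a, b, a + b}"
  unfolding set_all_bits[symmetric] by (auto simp: all_bits_def)

text \<open>
  The values of three vectors with kernels on the coordinate axes are governed by \<open>three_planes\<close>:
  either all values of \<open>S\<close> lie in one plane, or the vectors are the standard alternating
  matrices, and then all of \<open>D\<close> is alternating by \<open>alternating_maximal\<close>.
\<close>

lemma classify_stable:
  assumes V: "vector_space (bscale :: bit \<Rightarrow> 'v::ab_group_add \<Rightarrow> 'v)"
    and f: "additive (f :: bits \<Rightarrow> 'u::ab_group_add \<Rightarrow> 'v)" "inj f" "range f = S" "\<And>c. additive (f c)"
    and red: "reduced bscale S"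
    and lines: "kernel_line f u1 (1,0,0)" "kernel_line f u2 (0,1,0)" "kernel_line f u3 (0,0,1)"
    and stable: "\<And>u k u'. kernel_line f u k \<Longrightarrow> f k u' \<in> range (\<lambda>c. f c u)"
  shows "vector_space.dim bscale (UNIV :: 'v set) = 2 \<or> models (set (span_list (columns_c ! 0))) S"
proof -
  note dbl = double_zero[OF V]
  have eq: "x + y = 0 \<longleftrightarrow> x = y" for x y :: 'v by (metis dbl add_left_cancel)
  interpret V: vector_space "bscale :: bit \<Rightarrow> 'v \<Rightarrow> 'v" by (rule V)
  let ?e1 = "(1,0,0) :: bits" and ?e2 = "(0,1,0) :: bits" and ?e3 = "(0,0,1) :: bits"
  have fc: "f c u = comb (f ?e1 u, f ?e2 u, f ?e3 u) c" for c u
    unfolding comb_apply[symmetric] additive_eq_comb[OF f(1), symmetric] ..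
  define a b c d e g where "a = f ?e2 u1" and "b = f ?e3 u1" and "c = f ?e1 u2" and "d = f ?e3 u2"
    and "e = f ?e1 u3" and "g = f ?e2 u3"
  note abc = a_def b_def c_def d_def e_def g_def
  have zero: "f ?e1 u1 = 0" "f ?e2 u2 = 0" "f ?e3 u3 = 0"
    using lines unfolding kernel_line_def by blast+
  have fu: "f x u1 = comb (0, a, b) x" "f x u2 = comb (c, 0, d) x" "f x u3 = comb (e, g, 0) x" for x
    unfolding fc[of x] abc zero by (rule refl)+
  have inj_line: "f x u1 \<noteq> 0" if "x \<noteq> 0" "x \<noteq> ?e1" for x
    using lines(1) that unfolding kernel_line_def by blast
  have inj_line2: "f x u2 \<noteq> 0" if "x \<noteq> 0" "x \<noteq> ?e2" for x
    using lines(2) that unfolding kernel_line_def by blast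
  have inj_line3: "f x u3 \<noteq> 0" if "x \<noteq> 0" "x \<noteq> ?e3" for x
    using lines(3) that unfolding kernel_line_def by blast
  have nz: "a \<noteq> 0" "b \<noteq> 0" "a \<noteq> b" "c \<noteq> 0" "d \<noteq> 0" "c \<noteq> d" "e \<noteq> 0" "g \<noteq> 0" "e \<noteq> g"
    using inj_line[of ?e2] inj_line[of ?e3] inj_line[of "(0,1,1)"]
      inj_line2[of ?e1] inj_line2[of ?e3] inj_line2[of "(1,0,1)"]
      inj_line3[of ?e1] inj_line3[of ?e2] inj_line3[of "(1,1,0)"]
    unfolding fu by (simp_all add: zero_prod_def eq)
  have W: "f ?e1 y \<in> {0, a, b, a + b}" "f ?e2 y \<in> {0, c, d, c + d}" "f ?e3 y \<in> {0, e, g, e + g}" for y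
    using stable[OF lines(1), of y] stable[OF lines(2), of y] stable[OF lines(3), of y]
    unfolding fu range_comb_zero by blast+
  have "({0, c, d, c + d} = {0, a, b, a + b} \<and> {0, e, g, e + g} = {0, a, b, a + b}) \<or>
      (c = a \<and> e = b \<and> g = d \<and> d \<noteq> a + b)"
    by (rule three_planes[OF dbl nz])
      (use W(1)[of u2] W(1)[of u3] W(2)[of u1] W(2)[of u3] W(3)[of u1] W(3)[of u2] in \<open>simp_all only: abc\<close>)
  then show ?thesis
  proof
    assume flat: "{0, c, d, c + d} = {0, a, b, a + b} \<and> {0, e, g, e + g} = {0, a, b, a + b}"
    have span: "V.span {a, b} = {0, a, b, a + b}"
      using set_span_list[OF V, of "[a, b]"] by (simp add: insert_commute)
    have "f x y \<in> {0, a, b, a + b}" for x y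
    proof -
      have "f ?e1 y \<in> V.span {a, b}" "f ?e2 y \<in> V.span {a, b}" "f ?e3 y \<in> V.span {a, b}"
        unfolding span using W[of y] flat by blast+
      then have "comb (f ?e1 y, f ?e2 y, f ?e3 y) x \<in> V.span {a, b}"
        by (cases x) (simp only: comb.simps V.span_add V.span_scale)
      then show ?thesis unfolding fc[symmetric] span .
    qed
    then show ?thesis using dim_plane[OF V f(3) red nz(1-3)] by blast
  next
    assume alt: "c = a \<and> e = b \<and> g = d \<and> d \<noteq> a + b"
    have v: "indep3 (a, b, d)" using nz alt by (simp add: indep3_iff[OF V])
    let ?v = "(a, b, d)"
    have inj_v: "inj (comb ?v)" by (rule indep3_inj[OF V v])
    have inside: "f x y \<in> range (comb ?v)" for x y
    proof -
      have abd: "0 \<in> V.span {a, b, d}" "a \<in> V.span {a, b, d}" "b \<in> V.span {a, b, d}" "d \<in> V.span {a, b, d}"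
        by (simp_all add: V.span_zero V.span_base)
      have "{0, a, b, a + b} \<subseteq> V.span {a, b, d}" "{0, c, d, c + d} \<subseteq> V.span {a, b, d}"
        "{0, e, g, e + g} \<subseteq> V.span {a, b, d}"
        using alt by (simp_all only: insert_subset empty_subsetI abd V.span_add simp_thms)
      then have "f ?e1 y \<in> V.span {a, b, d}" "f ?e2 y \<in> V.span {a, b, d}" "f ?e3 y \<in> V.span {a, b, d}"
        using W[of y] by (blast dest: subsetD)+
      then have "comb (f ?e1 y, f ?e2 y, f ?e3 y) x \<in> V.span {a, b, d}"
        by (cases x) (simp only: comb.simps V.span_add V.span_scale)
      then show ?thesis unfolding fc[symmetric] independent_frame(3)[OF V v] .
    qed
    obtain \<theta> where \<theta>: "\<And>x y. f x y = comb ?v (comb (\<theta> y) x)" "models (range \<theta>) S"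
      using models_frame[OF V f v inside red] by blast
    have vu: "comb ?v (1,0,0) = a" "comb ?v (0,1,0) = b" "comb ?v (0,0,1) = d" "comb ?v (0,0,0) = 0"
      by simp_all
    let ?A = "set (span_list (columns_c ! 0))"
    have fu: "f ?e1 u1 = 0" "f ?e2 u1 = a" "f ?e3 u1 = b" "f ?e1 u2 = a" "f ?e2 u2 = 0" "f ?e3 u2 = d"
      "f ?e1 u3 = b" "f ?e2 u3 = d" "f ?e3 u3 = 0"
      using alt zero unfolding abc by simp_all
    have "\<theta> u1 = ((0,0,0), (1,0,0), (0,1,0))"
      by (rule coordinates_eqI[OF inj_v \<theta>(1)]) (simp_all only: vu fu)
    moreover have "\<theta> u2 = ((1,0,0), (0,0,0), (0,0,1))"
      by (rule coordinates_eqI[OF inj_v \<theta>(1)]) (simp_all only: vu fu)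
    moreover have "\<theta> u3 = ((0,1,0), (0,0,1), (0,0,0))"
      by (rule coordinates_eqI[OF inj_v \<theta>(1)]) (simp_all only: vu fu)
    ultimately have "((0,0,0), (1,0,0), (0,1,0)) \<in> range \<theta>" "((1,0,0), (0,0,0), (0,0,1)) \<in> range \<theta>"
      "((0,1,0), (0,0,1), (0,0,0)) \<in> range \<theta>" by (metis rangeI)+
    then have sub: "?A \<subseteq> range \<theta>"
      using set_span_list[OF vector_space_mat3] models_additive[OF \<theta>(2)]
      by (simp add: columns_c_def image_subset_iff del: add_Pair)
    have "range \<theta> \<subseteq> ?A"
    proof
      fix n assume "n \<in> range \<theta>"
      then obtain y where n: "n = \<theta> y" by blast
      have "comb n k \<in> set (map (comb m) all_bits)"
        if mk: "m \<in> ?A" "k \<noteq> 0" "m \<noteq> 0" "comb m k = 0" for m k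
      proof -
        obtain w where w: "m = \<theta> w" using sub mk(1) by blast
        have f0: "f x w = 0 \<longleftrightarrow> comb m x = 0" for x
          using v unfolding \<theta>(1) w indep3_def by (metis comb_zero_right)
        have "kernel_line f w k"
          unfolding kernel_line_def f0 using mk alternating_lines unfolding set_all_bits
          by (metis UNIV_I comb_zero_right)
        then have "f k y \<in> range (\<lambda>x. f x w)" by (rule stable)
        then obtain x where "comb ?v (comb n k) = comb ?v (comb m x)" unfolding \<theta>(1) n w by blast
        then have "comb n k = comb m x" using inj_v by (metis injD)
        then show ?thesis unfolding set_map set_all_bits by blast
      qed
      then show "n \<in> ?A"
        using alternating_maximal unfolding set_all_bits by (metis UNIV_I prod_cases3)
    qed
    then show ?thesis using sub \<theta>(2) by (metis subset_antisym)
  qed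
qed

lemma classification:
  assumes U: "vector_space (bscale :: bit \<Rightarrow> 'u::ab_group_add \<Rightarrow> 'u)"
    and V: "vector_space (bscale :: bit \<Rightarrow> 'v::ab_group_add \<Rightarrow> 'v)"
    and S: "operator_space bscale bscale S" "operator_dim bscale (S :: ('u \<Rightarrow> 'v) set) = 3"
    and red: "reduced bscale S" and min: "minimal_LLD bscale S"
  shows "vector_space.dim bscale (UNIV :: 'v set) = 2 \<or> (\<exists>ns\<in>set all_columns. models (set (span_list ns)) S)"
proof -
  obtain f where f: "additive f" "inj f" "range f = S" "\<And>c :: bits. additive (f c)"
    using operator_space_frame[OF U V S] by metis
  show ?thesis
  proof (cases "\<exists>u k u'. kernel_line f u k \<and> f k u' \<notin> range (\<lambda>c. f c u)")
    case True
    then show ?thesis using classify_escaping[OF V f red] min unfolding minimal_LLD_def by blast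
  next
    case False
    obtain k1 k2 k3 u1 u2 u3 where K: "indep3 (k1, k2, k3)"
      and line: "kernel_line f u1 k1" "kernel_line f u2 k2" "kernel_line f u3 k3"
      using minimal_LLD_kernel_frame[OF V f(1,2)] min f(3) by metis
    let ?K = "(k1, k2, k3)"
    let ?f = "\<lambda>c. f (comb ?K c)"
    have bK: "bij (comb ?K)" by (rule indep3_bij[OF K])
    have line_iff: "kernel_line ?f u k \<longleftrightarrow> kernel_line f u (comb ?K k)" for u k
    proof -
      have inj: "comb ?K x = comb ?K y \<longleftrightarrow> x = y" for x y using bK by (simp only: bij_def inj_eq)
      have z: "comb ?K x = 0 \<longleftrightarrow> x = 0" for x using inj[of x 0] by (simp only: comb_zero_right)
      have all: "(\<forall>c. Q c) \<longleftrightarrow> (\<forall>c. Q (comb ?K c))" for Q using bK by (metis bij_pointE)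
      show ?thesis
        unfolding kernel_line_def all[of "\<lambda>c. f c u = 0 \<longleftrightarrow> c = 0 \<or> c = comb ?K k"] inj z by (rule refl)
    qed
    have lines: "kernel_line ?f u1 (1,0,0)" "kernel_line ?f u2 (0,1,0)" "kernel_line ?f u3 (0,0,1)"
      unfolding line_iff using line by simp_all
    have stable: "?f k u' \<in> range (\<lambda>c. ?f c u)" if "kernel_line ?f u k" for u k u'
    proof -
      have "f (comb ?K k) u' \<in> range (\<lambda>c. f c u)" using that False unfolding line_iff by blast
      then obtain c where "f (comb ?K k) u' = f c u" by blast
      moreover obtain c' where "c = comb ?K c'" using bK by (metis bij_pointE)
      ultimately show ?thesis by blast
    qed
    have "columns_c ! 0 \<in> set all_columns" by (simp add: all_columns_def columns_c_def)
    then show ?thesis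
      using classify_stable[OF V frame_change[OF f(1-3) K] f(4) red lines stable] by blast
  qed
qed

section \<open>The classification\<close>

lemma exactly_one_Nil: "\<not> exactly_one []"
  by (simp add: exactly_one_def Ex1_def)

lemma exactly_one_Cons:
  "exactly_one (P # Ps) \<longleftrightarrow> (P \<and> (\<forall>Q\<in>set Ps. \<not> Q)) \<or> (\<not> P \<and> exactly_one Ps)"
proof (cases P)
  case True
  have "exactly_one (P # Ps) \<longleftrightarrow> (\<forall>j<length Ps. \<not> Ps ! j)"
  proof
    assume ex: "exactly_one (P # Ps)"
    have "\<not> Ps ! j" if j: "j < length Ps" for j
    proof
      assume "Ps ! j"
      then have "Suc j = 0" using ex j True unfolding exactly_one_def
        by (metis length_Cons nth_Cons_0 nth_Cons_Suc Suc_less_eq zero_less_Suc)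
      then show False by simp
    qed
    then show "\<forall>j<length Ps. \<not> Ps ! j" by blast
  next
    assume none: "\<forall>j<length Ps. \<not> Ps ! j"
    show "exactly_one (P # Ps)"
      unfolding exactly_one_def
    proof (rule ex1I[of _ 0])
      fix j assume "j < length (P # Ps) \<and> (P # Ps) ! j"
      then show "j = 0" using none by (cases j) auto
    qed (use True in simp)
  qed
  then show ?thesis using True by (simp add: all_set_conv_all_nth)
next
  case False
  have shift: "k < length (P # Ps) \<and> (P # Ps) ! k \<longleftrightarrow> (\<exists>i. k = Suc i \<and> i < length Ps \<and> Ps ! i)" for k
    using False by (cases k) auto
  have "exactly_one (P # Ps) \<longleftrightarrow> exactly_one Ps"
    unfolding exactly_one_def shift by blast
  then show ?thesis using False by simp
qed

lemma column_lengths: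
  "length columns_b = 2" "\<forall>ns\<in>set columns_c. length ns = 3" "\<forall>ns\<in>set columns_d. length ns = 4"
  "length columns_e = 5"
  by (simp_all add: columns_b_def columns_c_def columns_d_def columns_e_def)

lemma all_columns_cases:
  assumes "ns \<in> set all_columns"
  obtains "ns = columns_b" | "ns \<in> set columns_c" | "ns \<in> set columns_d" | "ns = columns_e"
  using assms unfolding all_columns_def by auto

lemma all_singular_frames:
  assumes "ns \<in> set all_columns"
  shows "\<exists>K. singular_frame ns K"
  using assms by (cases rule: all_columns_cases) (use singular_frames in blast)+

text \<open>
  Each generic matrix that represents \<open>S\<close> yields the same value of the invariant of \<open>S\<close>.
\<close>

lemma exactly_one_represented:
  assumes U: "vector_space (bscale :: bit \<Rightarrow> 'u::ab_group_add \<Rightarrow> 'u)"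
    and V: "vector_space (bscale :: bit \<Rightarrow> 'v::ab_group_add \<Rightarrow> 'v)"
    and ns: "ns \<in> set mss" "models (set (span_list ns)) (S :: ('u \<Rightarrow> 'v) set)"
    and mss: "set mss \<subseteq> set all_columns" "distinct (map (\<lambda>ms. interlock_count (span_list ms)) mss)"
  shows "exactly_one (map (\<lambda>G. represents bscale bscale (matrix_space G) S) (map generic_of mss))"
proof -
  have frame: "\<exists>K. singular_frame ms K" if "ms \<in> set mss" for ms
    using that mss(1) all_singular_frames by (meson subsetD)
  have dist: "distinct (span_list ms)" if "ms \<in> set mss" for ms
    using frame[OF that] unfolding singular_frame_def by blast
  obtain i where i: "i < length mss" "mss ! i = ns" using ns(1) by (metis in_set_conv_nth)
  show ?thesis
    unfolding exactly_one_def
  proof (rule ex1I[of _ i])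
    show "i < length (map (\<lambda>G. represents bscale bscale (matrix_space G) S) (map generic_of mss)) \<and>
        map (\<lambda>G. represents bscale bscale (matrix_space G) S) (map generic_of mss) ! i"
      using i models_represents(1)[OF U V dist[OF ns(1)] ns(2)] by simp
  next
    fix j
    assume "j < length (map (\<lambda>G. represents bscale bscale (matrix_space G) S) (map generic_of mss)) \<and>
        map (\<lambda>G. represents bscale bscale (matrix_space G) S) (map generic_of mss) ! j"
    then have j: "j < length mss" "represents bscale bscale (matrix_space (generic_of (mss ! j))) S" by auto
    then have mem: "mss ! j \<in> set mss" by simp
    then obtain K where "singular_frame (mss ! j) K" using frame by blast
    then have "models (set (span_list (mss ! j))) S" by (rule represents_models[OF U V _ j(2)])
    then have "interlock_count (span_list (mss ! j)) = interlock_count (span_list ns)"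
      using interlocks_models dist mem ns by metis
    then have "map (\<lambda>ms. interlock_count (span_list ms)) mss ! j = map (\<lambda>ms. interlock_count (span_list ms)) mss ! i"
      using i j(1) by simp
    then show "j = i" using mss(2) i(1) j(1) by (simp only: nth_eq_iff_index_eq length_map)
  qed
qed

theorem theorem5p1:
  fixes scaleU :: "bit \<Rightarrow> 'u::ab_group_add \<Rightarrow> 'u" and BU :: "'u set"
    and scaleV :: "bit \<Rightarrow> 'v::ab_group_add \<Rightarrow> 'v" and BV :: "'v set"
  assumes "finite_dimensional_vector_space scaleU BU"
    and "finite_dimensional_vector_space scaleV BV"
  defines "dimU \<equiv> vector_space.dim scaleU UNIV"
    and "dimV \<equiv> vector_space.dim scaleV UNIV"
  shows
    "(\<forall>S. operator_space scaleU scaleV S \<and> operator_dim scaleV S = 3 \<and>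
          reduced scaleV S \<and> minimal_LLD scaleV S \<longrightarrow>
        exactly_one
         [dimV = 2,
          dimU = 2 \<and> dimV = 3 \<and>
            represents scaleU scaleV (matrix_space generic_b) S,
          dimU = 3 \<and> dimV = 3 \<and>
            exactly_one (map (\<lambda>G. represents scaleU scaleV (matrix_space G) S) generic_c),
          dimU = 4 \<and> dimV = 3 \<and>
            exactly_one (map (\<lambda>G. represents scaleU scaleV (matrix_space G) S) generic_d),
          dimU = 5 \<and> dimV = 3 \<and>
            represents scaleU scaleV (matrix_space generic_e) S]) \<and>
     (\<forall>G \<in> set ([generic_b] @ generic_c @ generic_d @ [generic_e]).
        matrix_space G \<subseteq> carrier_mat dimV dimU \<longrightarrow>
          (\<exists>S. represents scaleU scaleV (matrix_space G) S) \<and>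
          (\<forall>S. represents scaleU scaleV (matrix_space G) S \<longrightarrow>
             operator_space scaleU scaleV S \<and> operator_dim scaleV S = 3 \<and>
             minimal_LLD scaleV S))"
proof -
  have "vector_space scaleU" "vector_space scaleV"
    using assms(1,2) by (simp_all add: finite_dimensional_vector_space_def)
  then have scale: "scaleU = bscale" "scaleV = bscale" by (simp_all add: scale_eq_bscale)
  then have U: "vector_space (bscale :: bit \<Rightarrow> 'u \<Rightarrow> 'u)" and V: "vector_space (bscale :: bit \<Rightarrow> 'v \<Rightarrow> 'v)"
    using \<open>vector_space scaleU\<close> \<open>vector_space scaleV\<close> by simp_all
  have dims: "vector_space.dim bscale (UNIV :: 'u set) = dimU" "vector_space.dim bscale (UNIV :: 'v set) = dimV"
    unfolding dimU_def dimV_def scale by (rule refl)+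
  note model = models_represents[OF U V, unfolded dims]
  have counts: "distinct (map (\<lambda>ms. interlock_count (span_list ms)) columns_c)"
    "distinct (map (\<lambda>ms. interlock_count (span_list ms)) columns_d)"
    unfolding interlock_counts by simp_all
  have sub: "set columns_c \<subseteq> set all_columns" "set columns_d \<subseteq> set all_columns"
    unfolding all_columns_def by auto
  have "exactly_one
         [dimV = 2,
          dimU = 2 \<and> dimV = 3 \<and> represents bscale bscale (matrix_space generic_b) S,
          dimU = 3 \<and> dimV = 3 \<and> exactly_one (map (\<lambda>G. represents bscale bscale (matrix_space G) S) generic_c),
          dimU = 4 \<and> dimV = 3 \<and> exactly_one (map (\<lambda>G. represents bscale bscale (matrix_space G) S) generic_d),
          dimU = 5 \<and> dimV = 3 \<and> represents bscale bscale (matrix_space generic_e) S]"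
    if S: "operator_space bscale bscale S" "operator_dim bscale S = 3" "reduced bscale S" "minimal_LLD bscale S"
    for S :: "('u \<Rightarrow> 'v) set"
  proof (cases "dimV = 2")
    case True
    then show ?thesis by (simp add: exactly_one_Cons exactly_one_Nil)
  next
    case False
    then obtain ns where ns: "ns \<in> set all_columns" "models (set (span_list ns)) S"
      using classification[OF U V S] unfolding dims by blast
    then have "distinct (span_list ns)" using all_singular_frames[OF ns(1)] unfolding singular_frame_def by metis
    note m = model[OF this ns(2)]
    show ?thesis using ns(1)
    proof (cases rule: all_columns_cases)
      case 1
      then show ?thesis using m column_lengths
        by (simp add: exactly_one_Cons exactly_one_Nil generic_of_columns)
    next
      case 2
      then show ?thesis using m column_lengths exactly_one_represented[OF U V 2 ns(2) sub(1) counts(1)]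
        unfolding generic_of_columns by (simp add: exactly_one_Cons exactly_one_Nil)
    next
      case 3
      then show ?thesis using m column_lengths exactly_one_represented[OF U V 3 ns(2) sub(2) counts(2)]
        unfolding generic_of_columns by (simp add: exactly_one_Cons exactly_one_Nil)
    next
      case 4
      then show ?thesis using m column_lengths
        by (simp add: exactly_one_Cons exactly_one_Nil generic_of_columns)
    qed
  qed
  moreover have "(\<exists>S :: ('u \<Rightarrow> 'v) set. represents bscale bscale (matrix_space G) S) \<and>
      (\<forall>S :: ('u \<Rightarrow> 'v) set. represents bscale bscale (matrix_space G) S \<longrightarrow>
         operator_space bscale bscale S \<and> operator_dim bscale S = 3 \<and> minimal_LLD bscale S)"
    if G: "G \<in> set ([generic_b] @ generic_c @ generic_d @ [generic_e])" "matrix_space G \<subseteq> carrier_mat dimV dimU" for G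
  proof -
    obtain ns where ns: "ns \<in> set all_columns" "G = generic_of ns"
      using G(1) unfolding all_columns_def generic_of_columns by auto
    obtain K where K: "singular_frame ns K" using all_singular_frames[OF ns(1)] by blast
    then have dist: "distinct (span_list ns)" unfolding singular_frame_def by blast
    have "generic_of ns 0 0 0 \<in> carrier_mat dimV dimU" using G(2) ns(2) unfolding matrix_space_def by blast
    then have len: "dimV = 3" "dimU = length ns" by (auto simp: generic_of_def)
    have "length ns \<in> {2, 3, 4, 5}"
      using column_lengths by (cases rule: all_columns_cases[OF ns(1)]) simp_all
    then have "length ns > 0" by auto
    then obtain S :: "('u \<Rightarrow> 'v) set" where "models (set (span_list ns)) S"
      using exists_models[OF U V dist singular_frame_nondegenerate[OF K]] len unfolding dims by blast
    then have "\<exists>S :: ('u \<Rightarrow> 'v) set. represents bscale bscale (matrix_space G) S"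
      using model(1)[OF dist] ns(2) by blast
    moreover have "operator_space bscale bscale S \<and> operator_dim bscale S = 3 \<and> minimal_LLD bscale S"
      if "represents bscale bscale (matrix_space G) S" for S :: "('u \<Rightarrow> 'v) set"
    proof -
      have "models (set (span_list ns)) S" using represents_models[OF U V K] that ns(2) by blast
      then show ?thesis using models_operator_space[OF U V] models_minimal_LLD[OF V _ K] by blast
    qed
    ultimately show ?thesis by blast
  qed
  ultimately show ?thesis unfolding scale by blast
qed

end
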